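(* Assume that the single-site potentials are bounded perturbations of convex potentials: $\psi_i=\psi_{i,b}+\psi_{i,c}$ and there is a constant $C_\psi$, independent of $i$, with $\psi_{i,c}''(r)\ge0$ and $|\psi_{i,b}(r)|+|\psi_{i,b}'(r)|\le C_\psi$ for all $r\in\mathbb{R}$; that the interaction is diagonally dominant: there is $\delta>0$ with $\delta+\sum_{j\ne i}|M_{ij}|\le M_{ii}$ for all $i$; and that there are constants $C_M,\alpha_M>0$ with $|M_{ij}|\le C_M[1+|i-j|]^{-(2d+\alpha_M)}$ for all $i,j$. Then the following two conditions are equivalent: (DC) There are finite constants $C,\alpha,\beta>0$ such that for every finite $\Lambda\subset\mathbb{Z}^d$, every boundary condition $\omega$ and all functions $f,g$ with supports in $\Lambda$, $$|\operatorname{cov}_{\mu_\Lambda^\omega}(f,g)|\le C\frac{|\operatorname{supp} f|^\beta|\operatorname{supp} g|^\beta}{[1+\operatorname{dist}(\operatorname{supp} f,\operatorname{supp} g)]^{d+\alpha}}|\nabla f|_{L^\infty}|\nabla g|_{L^\infty}.$$ (DS) There are finite constants $C,\alpha,\beta>0$ such that for every finite $\Lambda\subset\mathbb{Z}^d$, every function $f$ with support in $\Lambda$, every site $i\in\mathbb{Z}^d\setminus\Lambda$ and all boundary conditions $\omega,\tilde\omega$ with $\tilde\omega_k=\omega_k$ for all $k\ne i$, $$\Big|\int f\,d\mu_\Lambda^\omega-\int f\,d\mu_\Lambda^{\tilde\omega}\Big|\le C\frac{|\operatorname{supp} f|^\beta}{[1+\operatorname{dist}(\operatorname{supp} f,i)]^{d+\alpha}}|\tilde\omega_i-\omega_i|\,|\nabla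 f|_{L^\infty}.$$
   Context: Setting. Fix $d\ge1$, functions $\psi_i:\mathbb{R}\to\mathbb{R}$ (single-site potentials), numbers $s_i\in\mathbb{R}$ (external field), for $i\in\mathbb{Z}^d$, and a symmetric real matrix $(M_{ij})_{i,j\in\mathbb{Z}^d}$. Write $|i|=\max_k|i_k|$ for $i\in\mathbb{Z}^d$. For finite $\Lambda\subset\mathbb{Z}^d$ and $\omega=(\omega_j)_{j\notin\Lambda}$, the finite volume Gibbs measure is the probability measure on $\mathbb{R}^\Lambda$ $$d\mu_\Lambda^\omega=\frac1{Z_\Lambda^\omega}\exp\Big\{-\sum_{i\in\Lambda}(\psi_i(x_i)+s_ix_i)-\sum_{i,j\in\Lambda}M_{ij}x_ix_j-2\sum_{i\in\Lambda,j\notin\Lambda}M_{ij}x_i\omega_j\Big\}dx .$$ Only well-tempered boundary conditions are considered: $\max_{i\in\Lambda}\sum_{j\notin\Lambda}|M_{ij}||\omega_j|<\infty$. Functions are smooth functions of $(x_i)_{i\in\Lambda}$ with bounded derivatives. $\nabla_i$ is the partial derivative with respect to $x_i$ and $\nabla f=(\nabla_if)_{i\in\Lambda}$. $\operatorname{supp}f$ is the set of sites on whose spin values $f$ depends, $|\operatorname{supp} f|$ its cardinality, and $\operatorname{dist}$ is the distance for $|\cdot|$. $|\nabla f|_{L^\infty}$ is the supremum of $|\nabla f|$. *)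

theory Defs
  imports "HOL-Probability.Probability"
begin

text \<open>
  Sites are elements of \<^typ>\<open>int ^ 'd\<close>, so \<open>d = CARD('d) \<ge> 1\<close>.  A configuration is a total
  function from sites to \<^typ>\<open>real\<close>.  A function on \<open>\<real>\<^sup>\<Lambda>\<close> is a function of configurations that
  depends only on the spins in \<open>\<Lambda>\<close>, and a boundary condition for \<open>\<Lambda>\<close> is a configuration of which
  only the values outside \<open>\<Lambda>\<close> are used.
\<close>

type_synonym 'd site = "int ^ 'd"
type_synonym 'd config = "'d site \<Rightarrow> real"

definition site_norm :: "'d::finite site \<Rightarrow> nat" where
  "site_norm i = (MAX k. nat \<bar>i $ k\<bar>)"

text \<open>
  The value of the distance from the empty set is \<open>0\<close>; it plays no role below, because an
  observable with empty support is constant and \<^term>\<open>real 0 powr \<beta> = 0\<close>.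
\<close>

definition site_dist :: "'d::finite site set \<Rightarrow> 'd site set \<Rightarrow> nat" where
  "site_dist A B = (INF (i, j) \<in> A \<times> B. site_norm (i - j))"


subsection \<open>Observables\<close>

definition depends_only_on :: "('d config \<Rightarrow> real) \<Rightarrow> 'd site set \<Rightarrow> bool" where
  "depends_only_on f \<Lambda> \<longleftrightarrow> (\<forall>x y. (\<forall>i\<in>\<Lambda>. x i = y i) \<longrightarrow> f x = f y)"

definition supp :: "('d config \<Rightarrow> real) \<Rightarrow> 'd site set" where
  "supp f = {i. \<exists>x t. f (x(i := t)) \<noteq> f x}"

definition partial :: "'d site \<Rightarrow> ('d config \<Rightarrow> real) \<Rightarrow> 'd config \<Rightarrow> real" where
  "partial i f x = deriv (\<lambda>t. f (x(i := t))) (x i)"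

abbreviation partials :: "'d site list \<Rightarrow> ('d config \<Rightarrow> real) \<Rightarrow> 'd config \<Rightarrow> real" where
  "partials is f \<equiv> foldr partial is f"

text \<open>
  Continuity refers to the product topology on configurations; for functions that depend only on a
  finite set \<open>\<Lambda>\<close> of spins it is continuity on \<open>\<real>\<^sup>\<Lambda>\<close>.
\<close>

definition smooth_in :: "'d site set \<Rightarrow> ('d config \<Rightarrow> real) \<Rightarrow> bool" where
  "smooth_in \<Lambda> f \<longleftrightarrow>
     (\<forall>is \<in> lists \<Lambda>. continuous_on UNIV (partials is f) \<and>
        (\<forall>i\<in>\<Lambda>. \<forall>x. (\<lambda>t. partials is f (x(i := t))) differentiable (at (x i))))"

text \<open>
  All derivatives of order at least one are bounded; the function itself need not be.
\<close>

definition bounded_derivatives :: "'d site set \<Rightarrow> ('d config \<Rightarrow> real) \<Rightarrow> bool" where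
  "bounded_derivatives \<Lambda> f \<longleftrightarrow> (\<forall>is \<in> lists \<Lambda>. is \<noteq> [] \<longrightarrow> bounded (range (partials is f)))"

definition observable :: "'d site set \<Rightarrow> ('d config \<Rightarrow> real) \<Rightarrow> bool" where
  "observable \<Lambda> f \<longleftrightarrow> depends_only_on f \<Lambda> \<and> smooth_in \<Lambda> f \<and> bounded_derivatives \<Lambda> f"

text \<open>
  The supremum of the Euclidean norm of the gradient; for finite \<open>\<Lambda>\<close> and \<^term>\<open>observable \<Lambda> f\<close> it is
  taken over a bounded set.
\<close>

definition grad_sup_norm :: "'d site set \<Rightarrow> ('d config \<Rightarrow> real) \<Rightarrow> real" where
  "grad_sup_norm \<Lambda> f = (SUP x. L2_set (\<lambda>i. partial i f x) \<Lambda>)"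


subsection \<open>Finite volume Gibbs measures\<close>

definition tempered :: "('d site \<Rightarrow> 'd site \<Rightarrow> real) \<Rightarrow> 'd site set \<Rightarrow> 'd config \<Rightarrow> bool" where
  "tempered M \<Lambda> \<omega> \<longleftrightarrow> (\<forall>i\<in>\<Lambda>. (\<lambda>j. \<bar>M i j\<bar> * \<bar>\<omega> j\<bar>) summable_on (- \<Lambda>))"

definition hamiltonian ::
  "('d site \<Rightarrow> real \<Rightarrow> real) \<Rightarrow> ('d site \<Rightarrow> real) \<Rightarrow> ('d site \<Rightarrow> 'd site \<Rightarrow> real) \<Rightarrow>
   'd site set \<Rightarrow> 'd config \<Rightarrow> 'd config \<Rightarrow> real" where
  "hamiltonian \<psi> s M \<Lambda> \<omega> x =
     (\<Sum>i\<in>\<Lambda>. \<psi> i (x i) + s i * x i)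
     + (\<Sum>i\<in>\<Lambda>. \<Sum>j\<in>\<Lambda>. M i j * x i * x j)
     + 2 * (\<Sum>i\<in>\<Lambda>. \<Sum>\<^sub>\<infinity>j\<in>-\<Lambda>. M i j * x i * \<omega> j)"

definition partition_function ::
  "('d site \<Rightarrow> real \<Rightarrow> real) \<Rightarrow> ('d site \<Rightarrow> real) \<Rightarrow> ('d site \<Rightarrow> 'd site \<Rightarrow> real) \<Rightarrow>
   'd site set \<Rightarrow> 'd config \<Rightarrow> real" where
  "partition_function \<psi> s M \<Lambda> \<omega> =
     (\<integral>x. exp (- hamiltonian \<psi> s M \<Lambda> \<omega> x) \<partial>(\<Pi>\<^sub>M i\<in>\<Lambda>. lborel))"

definition gibbs ::
  "('d site \<Rightarrow> real \<Rightarrow> real) \<Rightarrow> ('d site \<Rightarrow> real) \<Rightarrow> ('d site \<Rightarrow> 'd site \<Rightarrow> real) \<Rightarrow>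
   'd site set \<Rightarrow> 'd config \<Rightarrow> 'd config measure" where
  "gibbs \<psi> s M \<Lambda> \<omega> =
     density (\<Pi>\<^sub>M i\<in>\<Lambda>. lborel)
       (\<lambda>x. ennreal (exp (- hamiltonian \<psi> s M \<Lambda> \<omega> x) / partition_function \<psi> s M \<Lambda> \<omega>))"

definition cov :: "'a measure \<Rightarrow> ('a \<Rightarrow> real) \<Rightarrow> ('a \<Rightarrow> real) \<Rightarrow> real" where
  "cov \<mu> f g = (\<integral>x. (f x - (\<integral>y. f y \<partial>\<mu>)) * (g x - (\<integral>y. g y \<partial>\<mu>)) \<partial>\<mu>)"


subsection \<open>The two conditions\<close>

definition decay_of_correlations ::
  "('d::finite site \<Rightarrow> real \<Rightarrow> real) \<Rightarrow> ('d site \<Rightarrow> real) \<Rightarrow> ('d site \<Rightarrow> 'd site \<Rightarrow> real) \<Rightarrow> bool" where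
  "decay_of_correlations \<psi> s M \<longleftrightarrow>
     (\<exists>C>0. \<exists>\<alpha>>0. \<exists>\<beta>>0. \<forall>\<Lambda> \<omega> f g.
        finite \<Lambda> \<and> tempered M \<Lambda> \<omega> \<and> observable \<Lambda> f \<and> observable \<Lambda> g \<longrightarrow>
        \<bar>cov (gibbs \<psi> s M \<Lambda> \<omega>) f g\<bar> \<le>
          C * (real (card (supp f)) powr \<beta> * real (card (supp g)) powr \<beta>
               / (1 + real (site_dist (supp f) (supp g))) powr (real CARD('d) + \<alpha>))
            * grad_sup_norm \<Lambda> f * grad_sup_norm \<Lambda> g)"

definition decay_of_boundary_influence ::
  "('d::finite site \<Rightarrow> real \<Rightarrow> real) \<Rightarrow> ('d site \<Rightarrow> real) \<Rightarrow> ('d site \<Rightarrow> 'd site \<Rightarrow> real) \<Rightarrow> bool" where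
  "decay_of_boundary_influence \<psi> s M \<longleftrightarrow>
     (\<exists>C>0. \<exists>\<alpha>>0. \<exists>\<beta>>0. \<forall>\<Lambda> f i \<omega> \<omega>'.
        finite \<Lambda> \<and> observable \<Lambda> f \<and> i \<notin> \<Lambda> \<and> tempered M \<Lambda> \<omega> \<and> tempered M \<Lambda> \<omega>' \<and>
        (\<forall>k. k \<notin> \<Lambda> \<longrightarrow> k \<noteq> i \<longrightarrow> \<omega>' k = \<omega> k) \<longrightarrow>
        \<bar>(\<integral>x. f x \<partial>gibbs \<psi> s M \<Lambda> \<omega>) - (\<integral>x. f x \<partial>gibbs \<psi> s M \<Lambda> \<omega>')\<bar> \<le>
          C * (real (card (supp f)) powr \<beta>
               / (1 + real (site_dist (supp f) {i})) powr (real CARD('d) + \<alpha>))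
            * \<bar>\<omega>' i - \<omega> i\<bar> * grad_sup_norm \<Lambda> f)"

end

theory Submission
  imports Defs
begin

text \<open>
  The analytic input is a bound on the variance of a single spin that is uniform in the volume and in
  the boundary condition. Contract one coordinate towards its mean, \<open>x\<^sub>i \<mapsto> (1 - \<theta>) x\<^sub>i + \<theta> m\<^sub>i\<close>. The
  integral of the Boltzmann factor changes exactly by the Jacobian \<open>1 - \<theta>\<close>, while by convexity of
  \<open>\<psi>\<^sub>c\<close> the energy does not increase by more than explicit terms of first order in \<open>\<theta>\<close>; the terms
  linear in \<open>x\<^sub>i - m\<^sub>i\<close> have mean zero. Letting \<open>\<theta> \<rightarrow> 0\<close> yields
  \<open>2 \<Sum>\<^sub>j M\<^sub>i\<^sub>j cov(x\<^sub>i, x\<^sub>j) \<le> 1 + C\<^sub>\<psi> E \<bar>x\<^sub>i - m\<^sub>i\<bar>\<close> without any integrability of \<open>\<psi>\<^sub>c\<close> or its derivative,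
  and diagonal dominance, used at the site of maximal variance, closes the estimate.

  From (DS) to (DC): if the supports meet, the distance is \<open>0\<close> and the variance bound suffices.
  Otherwise replace \<open>f\<close> by its conditional expectation given the spins in \<open>supp g\<close>; by (DS) this is a
  Lipschitz function of those spins whose constant carries the decay.

  From (DC) to (DS): the derivative of \<open>\<integral> f d\<mu>\<^sup>\<omega>\<close> in \<open>\<omega>\<^sub>i\<close> is \<open>-2 \<Sum>\<^sub>j M\<^sub>j\<^sub>i cov(f, x\<^sub>j)\<close>, and the
  decays of \<open>M\<close> and of the correlations convolve.
\<close>

subsection \<open>Geometry of the lattice\<close>

lemma site_norm_le_iff: "site_norm i \<le> n \<longleftrightarrow> (\<forall>k. nat \<bar>i $ k\<bar> \<le> n)"
  by (auto simp: site_norm_def)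

lemma component_le_site_norm: "nat \<bar>i $ k\<bar> \<le> site_norm i"
  using site_norm_le_iff by blast

lemma site_norm_zero [simp]: "site_norm 0 = 0"
  using site_norm_le_iff[of 0 0] by simp

lemma site_norm_triangle: "site_norm (i + j) \<le> site_norm i + site_norm j"
proof -
  have "nat \<bar>(i + j) $ k\<bar> \<le> site_norm i + site_norm j" for k
    using component_le_site_norm[of i k] component_le_site_norm[of j k] abs_triangle_ineq[of "i $ k" "j $ k"]
    by (simp add: nat_le_iff)
  then show ?thesis using site_norm_le_iff by blast
qed

lemma site_norm_minus_commute: "site_norm (i - j) = site_norm (j - i)"
  by (simp add: site_norm_def abs_minus_commute)

lemma site_dist_le: "i \<in> A \<Longrightarrow> j \<in> B \<Longrightarrow> site_dist A B \<le> site_norm (i - j)"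
  unfolding site_dist_def by (rule cINF_lower2[of _ _ "(i, j)"]) auto

lemma site_dist_attained:
  assumes "A \<noteq> {}" "B \<noteq> {}"
  obtains i j where "i \<in> A" "j \<in> B" "site_dist A B = site_norm (i - j)"
proof -
  have "site_dist A B \<in> (\<lambda>(i, j). site_norm (i - j)) ` (A \<times> B)"
    unfolding site_dist_def by (rule Inf_nat_def1) (use assms in auto)
  then show ?thesis using that by auto
qed

text \<open>The point of \<open>A\<close> nearest to \<open>j\<close> is a competitor in the infimum
  for \<open>i\<close>.\<close>

lemma site_dist_triangle:
  assumes "A \<noteq> {}"
  shows "site_dist A {i} \<le> site_dist A {j} + site_norm (i - j)"
proof -
  obtain a where a: "a \<in> A" "site_dist A {j} = site_norm (a - j)"
    using site_dist_attained[OF assms, of "{j}"] by auto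
  have "site_dist A {i} \<le> site_norm ((a - j) + (j - i))"
    using site_dist_le[OF a(1), of i "{i}"] by simp
  also have "\<dots> \<le> site_norm (a - j) + site_norm (j - i)" by (rule site_norm_triangle)
  finally show ?thesis by (simp add: a site_norm_minus_commute)
qed

text \<open>Rests on \<open>1 + a + b \<le> (1 + a) * (1 + b)\<close>. It lets a factor that decays
  in the distance from \<open>j\<close> to \<open>i\<close> move the base point of a correlation
  bound from \<open>j\<close> to \<open>i\<close>.\<close>

lemma site_dist_powr_triangle:
  assumes "A \<noteq> {}" "p \<ge> 0"
  shows "(1 + real (site_norm (i - j))) powr (-p) * (1 + real (site_dist A {j})) powr (-p)
    \<le> (1 + real (site_dist A {i})) powr (-p)"
proof -
  have "real (site_dist A {i}) \<le> real (site_dist A {j}) + real (site_norm (i - j))"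
    using site_dist_triangle[OF assms(1), of i j] by linarith
  moreover have "0 \<le> real (site_norm (i - j)) * real (site_dist A {j})" by simp
  ultimately have "1 + real (site_dist A {i}) \<le> (1 + real (site_norm (i - j))) * (1 + real (site_dist A {j}))"
    unfolding ring_distribs by linarith
  then have "((1 + real (site_norm (i - j))) * (1 + real (site_dist A {j}))) powr (-p)
     \<le> (1 + real (site_dist A {i})) powr (-p)"
    using assms(2) by (intro powr_mono2') auto
  then show ?thesis by (simp add: powr_mult)
qed

section \<open>Uniform bounds for sums over the lattice\<close>

text \<open>The negative integers mirror the positive ones, so two copies of a convergent series
  suffice; 0 is counted twice. The bound is free of \<open>N\<close>.\<close>

lemma sum_int_powr_bounded:
  assumes "p > 1"
  shows "(\<Sum>n\<in>{- int N..int N}. (1 + real_of_int \<bar>n\<bar>) powr (-p)) \<le> 2 * (\<Sum>n. (1 + real n) powr (-p))"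
proof -
  let ?g = "\<lambda>n::int. (1 + real_of_int \<bar>n\<bar>) powr (-p)"
  have "summable (\<lambda>n. real n powr (-p))" using assms by (subst summable_real_powr_iff) auto
  then have s: "summable (\<lambda>n. (1 + real n) powr (-p))"
    using summable_Suc_iff[of "\<lambda>n. real n powr (-p)"] by (simp add: add.commute)
  have le: "(\<Sum>n\<le>N. (1 + real n) powr (-p)) \<le> (\<Sum>n. (1 + real n) powr (-p))"
    by (rule sum_le_suminf[OF s]) auto
  have "n \<in> int ` {..N} \<union> (\<lambda>n. - int n) ` {..N}" if "n \<in> {- int N..int N}" for n
  proof (cases "n \<ge> 0")
    case True
    then show ?thesis using that by (intro UnI1 image_eqI[of _ _ "nat n"]) auto
  next
    case False
    then show ?thesis using that by (intro UnI2 image_eqI[of _ _ "nat (-n)"]) auto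
  qed
  then have "{- int N..int N} \<subseteq> int ` {..N} \<union> (\<lambda>n. - int n) ` {..N}" by blast
  then have "sum ?g {- int N..int N} \<le> sum ?g (int ` {..N} \<union> (\<lambda>n. - int n) ` {..N})"
    by (intro sum_mono2) auto
  also have "\<dots> \<le> sum ?g (int ` {..N}) + sum ?g ((\<lambda>n. - int n) ` {..N})"
    by (subst sum.union_inter[symmetric]) (auto intro: sum_nonneg)
  also have "sum ?g (int ` {..N}) = (\<Sum>n\<le>N. (1 + real n) powr (-p))"
    by (subst sum.reindex) (auto simp: inj_on_def)
  also have "sum ?g ((\<lambda>n. - int n) ` {..N}) = (\<Sum>n\<le>N. (1 + real n) powr (-p))"
    by (subst sum.reindex) (auto simp: inj_on_def)
  finally show ?thesis using le by simp
qed

text \<open>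
  Since \<open>1 + \<bar>k\<bar> \<ge> 1 + \<bar>k\<^sub>c\<bar>\<close> for each of the \<open>d\<close> coordinates, a summand is at most the product over
  \<open>c\<close> of \<open>(1 + \<bar>k\<^sub>c\<bar>) powr - (1 + \<gamma> / d)\<close>, whose sum over a box factorizes.
\<close>

lemma lattice_sum_bounded:
  assumes "\<gamma> > 0"
  shows "\<exists>S. \<forall>A. finite A \<longrightarrow>
    (\<Sum>k\<in>A. (1 + real (site_norm (k :: 'd::finite site))) powr (- (real CARD('d) + \<gamma>))) \<le> S"
proof (intro exI allI impI)
  fix A :: "'d site set"
  assume A: "finite A"
  define p where "p = 1 + \<gamma> / real CARD('d)"
  define N where "N = Max (site_norm ` A)"
  define g where "g n = (1 + real_of_int \<bar>n\<bar>) powr (-p)" for n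
  \<comment> \<open>The box is written as an image of a function space because
    \<open>prod_sum_PiE\<close>, which factorizes the sum, speaks of functions and not of
    vectors.\<close>
  let ?B = "(\<lambda>f. (\<chi> c. f c) :: 'd site) ` (\<Pi>\<^sub>E c\<in>UNIV. {- int N..int N})"
  have p: "p > 1" using assms by (simp add: p_def)
  have pd: "p * real CARD('d) = real CARD('d) + \<gamma>" by (simp add: p_def field_simps)
  have pw: "(1 + real (site_norm k)) powr (- (real CARD('d) + \<gamma>)) \<le> (\<Prod>c\<in>UNIV. g (k $ c))"
    for k :: "'d site"
  proof -
    have "(1 + real (site_norm k)) powr (- (real CARD('d) + \<gamma>))
        = (\<Prod>c\<in>(UNIV::'d set). (1 + real (site_norm k)) powr (-p))"
      by (simp add: powr_powr[symmetric] powr_realpow[symmetric] pd[symmetric] powr_powr)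
    also have "\<dots> \<le> (\<Prod>c\<in>UNIV. g (k $ c))"
    proof (intro prod_mono conjI)
      fix c :: 'd
      have "real_of_int \<bar>k $ c\<bar> \<le> real (site_norm k)"
        using component_le_site_norm[of k c] by linarith
      then show "(1 + real (site_norm k)) powr (-p) \<le> g (k $ c)"
        unfolding g_def using p by (intro powr_mono2') auto
    qed auto
    finally show ?thesis .
  qed
  have inj: "inj_on (\<lambda>f. (\<chi> c. f c) :: 'd site) (\<Pi>\<^sub>E c\<in>UNIV. {- int N..int N})"
    by (auto simp: inj_on_def vec_eq_iff)
  have fin: "finite (\<Pi>\<^sub>E c\<in>(UNIV::'d set). {- int N..int N})" by (intro finite_PiE) auto
  have "k \<in> ?B" if k: "k \<in> A" for k
  proof (rule image_eqI[of _ _ "\<lambda>c. k $ c"])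
    have "site_norm k \<le> N" unfolding N_def using A k by simp
    then have "nat \<bar>k $ c\<bar> \<le> N" for c using component_le_site_norm[of k c] by linarith
    then have "k $ c \<in> {- int N..int N}" for c by (auto simp: nat_le_iff abs_le_iff) (smt (verit))+
    then show "(\<lambda>c. k $ c) \<in> (\<Pi>\<^sub>E c\<in>UNIV. {- int N..int N})" by auto
  qed simp
  then have "A \<subseteq> ?B" by blast
  have "(\<Sum>k\<in>A. (1 + real (site_norm k)) powr (- (real CARD('d) + \<gamma>))) \<le> (\<Sum>k\<in>A. \<Prod>c\<in>UNIV. g (k $ c))"
    by (intro sum_mono pw)
  also have "\<dots> \<le> (\<Sum>k\<in>?B. \<Prod>c\<in>UNIV. g (k $ c))"
    using \<open>A \<subseteq> ?B\<close> fin by (intro sum_mono2) (auto simp: g_def intro!: prod_nonneg)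
  also have "\<dots> = (\<Sum>f\<in>(\<Pi>\<^sub>E c\<in>(UNIV::'d set). {- int N..int N}). \<Prod>c\<in>UNIV. g (f c))"
    by (subst sum.reindex[OF inj]) simp
  also have "\<dots> = (\<Prod>c\<in>(UNIV::'d set). \<Sum>n\<in>{- int N..int N}. g n)"
    by (subst prod_sum_PiE) auto
  also have "\<dots> \<le> (\<Prod>c\<in>(UNIV::'d set). 2 * (\<Sum>n. (1 + real n) powr (-p)))"
    using sum_int_powr_bounded[OF p, of N] by (intro prod_mono) (auto simp: g_def intro!: sum_nonneg)
  \<comment> \<open>The existential witness is fixed here. It must not mention \<open>A\<close> or
    \<open>N\<close>, and \<open>p\<close>, being local, is unfolded.\<close>
  finally show "(\<Sum>k\<in>A. (1 + real (site_norm k)) powr (- (real CARD('d) + \<gamma>)))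
     \<le> (\<Prod>c\<in>(UNIV::'d set). 2 * (\<Sum>n. (1 + real n) powr (- (1 + \<gamma> / real CARD('d)))))"
    by (simp add: p_def)
qed

subsection \<open>Observables\<close>

lemma supp_subset: "depends_only_on f \<Lambda> \<Longrightarrow> supp f \<subseteq> \<Lambda>"
  unfolding supp_def depends_only_on_def by (auto, metis fun_upd_other)

text \<open>Each partial derivative is bounded and the Euclidean norm is at most the sum of the
  absolute values. Hence the supremum in \<open>grad_sup_norm\<close> runs over a set bounded above,
  without which it would carry no information.\<close>

lemma observable_partial_bound:
  assumes "finite \<Lambda>" "observable \<Lambda> f" "i \<in> \<Lambda>"
  shows "\<bar>partial i f x\<bar> \<le> grad_sup_norm \<Lambda> f"
    and bdd_above_gradient: "bdd_above (range (\<lambda>x. L2_set (\<lambda>i. partial i f x) \<Lambda>))"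
proof -
  have "\<forall>j\<in>\<Lambda>. \<exists>B. \<forall>x. \<bar>partial j f x\<bar> \<le> B"
  proof
    fix j assume "j \<in> \<Lambda>"
    then have "bounded (range (partials [j] f))"
      using assms(2) unfolding observable_def bounded_derivatives_def by (metis in_listsI list.simps(3)
          set_ConsD empty_iff list.set(1))
    then show "\<exists>B. \<forall>x. \<bar>partial j f x\<bar> \<le> B" by (auto simp: bounded_iff)
  qed
  then obtain B where B: "\<And>j x. j \<in> \<Lambda> \<Longrightarrow> \<bar>partial j f x\<bar> \<le> B j" by metis
  have "L2_set (\<lambda>i. partial i f x) \<Lambda> \<le> sum B \<Lambda>" for x
    using L2_set_le_sum_abs[of "\<lambda>i. partial i f x" \<Lambda>] sum_mono[of \<Lambda> "\<lambda>i. \<bar>partial i f x\<bar>" B] B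
    by fastforce
  then show bdd: "bdd_above (range (\<lambda>x. L2_set (\<lambda>i. partial i f x) \<Lambda>))"
    by (auto intro!: bdd_aboveI)
  have "\<bar>partial i f x\<bar> \<le> L2_set (\<lambda>i. \<bar>partial i f x\<bar>) \<Lambda>"
    by (rule member_le_L2_set) (use assms in auto)
  also have "\<dots> = L2_set (\<lambda>i. partial i f x) \<Lambda>" by (simp add: L2_set_def)
  also have "\<dots> \<le> grad_sup_norm \<Lambda> f"
    unfolding grad_sup_norm_def by (rule cSUP_upper[OF _ bdd]) auto
  finally show "\<bar>partial i f x\<bar> \<le> grad_sup_norm \<Lambda> f" .
qed

lemma grad_sup_norm_nonneg:
  assumes "finite \<Lambda>" "observable \<Lambda> f"
  shows "grad_sup_norm \<Lambda> f \<ge> 0"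
proof (cases "\<Lambda> = {}")
  case True
  then show ?thesis by (simp add: grad_sup_norm_def)
next
  case False
  then obtain i where "i \<in> \<Lambda>" by auto
  from observable_partial_bound(1)[OF assms this] show ?thesis by (rule order_trans[OF abs_ge_zero])
qed

lemma observable_Lipschitz_coordinate:
  assumes "finite \<Lambda>" "observable \<Lambda> f" "i \<in> \<Lambda>"
  shows "\<bar>f (x(i := t)) - f x\<bar> \<le> grad_sup_norm \<Lambda> f * \<bar>t - x i\<bar>"
proof -
  let ?g = "\<lambda>s. f (x(i := s))"
  have "(?g has_field_derivative partial i f (x(i := s))) (at s)" for s
  proof -
    have "\<forall>x. (\<lambda>t. partials [] f (x(i := t))) differentiable (at (x i))"
      using assms unfolding observable_def smooth_in_def by blast
    \<comment> \<open>\<open>smooth_in\<close> gives differentiability at the current value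
      \<open>x i\<close>; updating the configuration moves this point to \<open>s\<close>.\<close>
    from this[rule_format, of "x(i := s)"] have "?g differentiable (at s)" by simp
    then have "(?g has_field_derivative deriv ?g s) (at s)"
      by (simp add: DERIV_deriv_iff_real_differentiable)
    then show ?thesis by (simp add: partial_def)
  qed
  then have "norm (?g t - ?g (x i)) \<le> grad_sup_norm \<Lambda> f * norm (t - x i)"
    using observable_partial_bound(1)[OF assms]
    by (intro field_differentiable_bound[of UNIV _ "\<lambda>s. partial i f (x(i := s))"]) (auto simp del: fun_upd_apply)
  then show ?thesis by simp
qed

text \<open>Replacing the spins of \<open>x\<close> by those of \<open>y\<close> one at a time costs
  \<open>grad_sup_norm\<close> times the increment at a site of \<open>supp f\<close> and nothing
  elsewhere. The resulting l1 distance produces powers of the cardinality of the support, which the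
  exponent \<beta> absorbs.\<close>

lemma observable_Lipschitz:
  assumes "finite \<Lambda>" "observable \<Lambda> f"
  shows "\<bar>f x - f y\<bar> \<le> grad_sup_norm \<Lambda> f * (\<Sum>i\<in>supp f. \<bar>x i - y i\<bar>)"
proof -
  let ?L = "grad_sup_norm \<Lambda> f"
  have L: "?L \<ge> 0" by (rule grad_sup_norm_nonneg[OF assms])
  have sub: "supp f \<subseteq> \<Lambda>" using assms(2) by (simp add: supp_subset observable_def)
  \<comment> \<open>Generalized for the induction: \<open>S\<close> contains the sites of \<Lambda>
    where \<open>x\<close> and \<open>y\<close> may still differ.\<close>
  have "\<bar>f x - f y\<bar> \<le> ?L * (\<Sum>i\<in>S \<inter> supp f. \<bar>x i - y i\<bar>)"
    if "finite S" "S \<subseteq> \<Lambda>" "\<forall>i\<in>\<Lambda> - S. x i = y i" for S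
    using that
  proof (induction S arbitrary: x)
    case empty
    then have "f x = f y" using assms(2) by (simp add: observable_def depends_only_on_def)
    then show ?case by simp
  next
    case (insert i S)
    let ?x = "x(i := y i)"
    have IH: "\<bar>f ?x - f y\<bar> \<le> ?L * (\<Sum>j\<in>S \<inter> supp f. \<bar>?x j - y j\<bar>)"
      using insert by (intro insert.IH) auto
    also have "(\<Sum>j\<in>S \<inter> supp f. \<bar>?x j - y j\<bar>) = (\<Sum>j\<in>S \<inter> supp f. \<bar>x j - y j\<bar>)"
      using insert by (intro sum.cong) auto
    finally have *: "\<bar>f ?x - f y\<bar> \<le> ?L * (\<Sum>j\<in>S \<inter> supp f. \<bar>x j - y j\<bar>)" .
    show ?case
    proof (cases "i \<in> supp f")
      case True
      have "\<bar>f ?x - f x\<bar> \<le> ?L * \<bar>y i - x i\<bar>"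
        using observable_Lipschitz_coordinate[OF assms, of i] insert by auto
      then show ?thesis using * True insert
        by (simp add: Int_insert_left ring_distribs abs_minus_commute)
    next
      case False
      then have "f ?x = f x" by (auto simp: supp_def)
      then show ?thesis using * False by (simp add: Int_insert_left)
    qed
  qed
  from this[of \<Lambda>] have "\<bar>f x - f y\<bar> \<le> ?L * (\<Sum>i\<in>\<Lambda> \<inter> supp f. \<bar>x i - y i\<bar>)"
    using assms by simp
  then show ?thesis using sub by (simp add: Int_absorb1)
qed

text \<open>By definition \<open>supp\<close> sees only changes of a single spin; for finite
  \<Lambda> the Lipschitz bound extends this to arbitrary changes off the support.\<close>

lemma observable_depends_only_on_supp:
  assumes "finite \<Lambda>" "observable \<Lambda> f"
  shows "depends_only_on f (supp f)"
  unfolding depends_only_on_def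
proof (intro allI impI)
  fix x y :: "'a config" assume "\<forall>i\<in>supp f. x i = y i"
  then have "(\<Sum>i\<in>supp f. \<bar>x i - y i\<bar>) = 0" by (intro sum.neutral) auto
  then show "f x = f y" using observable_Lipschitz[OF assms, of x y] by simp
qed

text \<open>Iterated partial derivatives do not refer to the volume, so smoothness and boundedness
  are inherited. It is used to apply (DS) to \<open>f\<close> in the volume \<Lambda> without the
  support of \<open>g\<close>.\<close>

lemma observable_restrict:
  assumes "finite \<Lambda>" "observable \<Lambda> f" "supp f \<subseteq> \<Lambda>'" "\<Lambda>' \<subseteq> \<Lambda>"
  shows "observable \<Lambda>' f"
proof -
  have "lists \<Lambda>' \<subseteq> lists \<Lambda>" using assms(4) by (rule lists_mono)
  moreover have "depends_only_on f \<Lambda>'"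
    using observable_depends_only_on_supp[OF assms(1,2)] assms(3)
    unfolding depends_only_on_def by blast
  ultimately show ?thesis
    using assms(2,4) unfolding observable_def smooth_in_def bounded_derivatives_def by blast
qed

lemma grad_sup_norm_restrict:
  assumes "finite \<Lambda>" "observable \<Lambda> f" "\<Lambda>' \<subseteq> \<Lambda>"
  shows "grad_sup_norm \<Lambda>' f \<le> grad_sup_norm \<Lambda> f"
proof (cases "\<Lambda> = {}")
  case True
  then show ?thesis using assms by simp
next
  case False
  then obtain i where i: "i \<in> \<Lambda>" by auto
  show ?thesis
    unfolding grad_sup_norm_def
  proof (rule cSUP_mono[OF _ bdd_above_gradient[OF assms(1,2) i]])
    fix x
    have "L2_set (\<lambda>i. partial i f x) \<Lambda>' \<le> L2_set (\<lambda>i. partial i f x) \<Lambda>"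
      unfolding L2_set_def using assms by (intro real_sqrt_le_mono sum_mono2) auto
    then show "\<exists>y\<in>UNIV. L2_set (\<lambda>i. partial i f x) \<Lambda>' \<le> L2_set (\<lambda>i. partial i f y) \<Lambda>" by blast
  qed simp
qed

section \<open>Single spins as observables\<close>

lemma partial_const: "partial i (\<lambda>x. c) = (\<lambda>x. 0)"
  by (simp add: partial_def fun_eq_iff)

lemma partial_coordinate: "partial i (\<lambda>x. x j) = (\<lambda>x. if i = j then 1 else 0)"
  by (auto simp: partial_def fun_eq_iff)

lemma partials_coordinate: "is \<noteq> [] \<Longrightarrow> \<exists>c. partials is (\<lambda>x. x j) = (\<lambda>x. c)"
proof (induction "is")
  case (Cons i "is")
  then show ?case
    by (cases "is = []") (auto simp: partial_coordinate partial_const)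
qed simp

lemma supp_coordinate: "supp (\<lambda>x. x j) = {j}"
  by (auto simp: supp_def intro!: exI[of _ "\<lambda>_. 0"] exI[of _ 1])

lemma observable_coordinate:
  assumes "j \<in> \<Lambda>"
  shows "observable \<Lambda> (\<lambda>x. x j)"
proof -
  have "continuous_on UNIV (partials is (\<lambda>x. x j)) \<and>
     (\<forall>i\<in>\<Lambda>. \<forall>x. (\<lambda>t. partials is (\<lambda>x. x j) (x(i := t))) differentiable (at (x i)))" for "is"
  proof (cases "is = []")
    case True
    have "(\<lambda>t. (x(i := t)) j) differentiable at (x i)" for i and x :: "'a config"
      by (cases "i = j") auto
    then show ?thesis using True by (auto intro!: continuous_on_product_coordinates)
  next
    case False
    from partials_coordinate[OF this, of j] show ?thesis by auto
  qed
  moreover have "bounded (range (partials is (\<lambda>x. x j)))" if "is \<noteq> []" for "is"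
    using partials_coordinate[OF that, of j] by auto
  ultimately show ?thesis using assms
    by (auto simp: observable_def smooth_in_def bounded_derivatives_def depends_only_on_def)
qed

lemma grad_sup_norm_coordinate:
  assumes "finite \<Lambda>" "j \<in> \<Lambda>"
  shows "grad_sup_norm \<Lambda> (\<lambda>x. x j) = 1"
proof -
  have "(\<Sum>i\<in>\<Lambda>. (if i = j then 1 else 0 :: real)\<^sup>2) = (\<Sum>i\<in>\<Lambda>. if i = j then 1 else 0)"
    by (intro sum.cong) auto
  then have "L2_set (\<lambda>i. if i = j then 1 else 0 :: real) \<Lambda> = 1"
    using assms by (simp add: L2_set_def)
  then show ?thesis by (simp add: grad_sup_norm_def partial_coordinate)
qed

section \<open>Measurability through continuity\<close>

lemma coordinate_measurable:
  "i \<in> \<Lambda> \<Longrightarrow> (\<lambda>x. x i) \<in> borel_measurable (\<Pi>\<^sub>M i\<in>\<Lambda>. (lborel :: real measure))"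
  using measurable_component_singleton[of i \<Lambda> "\<lambda>_. lborel :: real measure"] by simp

text \<open>Elements of the product space are undefined off \<Lambda>, whereas continuity concerns
  all configurations. Filling up with 0 is measurable into the Borel space, since there are
  countably many sites, and leaves the value of \<open>f\<close> unchanged.\<close>

lemma continuous_measurable_PiM:
  fixes f :: "'d::finite config \<Rightarrow> real"
  assumes "continuous_on UNIV f" "depends_only_on f \<Lambda>"
  shows "f \<in> borel_measurable (\<Pi>\<^sub>M i\<in>\<Lambda>. lborel)"
proof -
  let ?r = "\<lambda>x i. if i \<in> \<Lambda> then x i else (0 :: real)"
  have f: "f \<in> borel_measurable borel" using assms(1) by (rule borel_measurable_continuous_onI)
  have "(\<lambda>x. ?r x i) \<in> borel_measurable (\<Pi>\<^sub>M i\<in>\<Lambda>. lborel)" for i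
    by (cases "i \<in> \<Lambda>") (auto intro: coordinate_measurable)
  then have "?r \<in> measurable (\<Pi>\<^sub>M i\<in>\<Lambda>. lborel) (\<Pi>\<^sub>M i\<in>UNIV. borel)"
    by (intro measurable_PiM_single') auto
  then have "?r \<in> measurable (\<Pi>\<^sub>M i\<in>\<Lambda>. lborel) borel"
    by (simp cong: measurable_cong_sets add: sets_PiM_equal_borel)
  from measurable_compose[OF this f] have "(\<lambda>x. f (?r x)) \<in> borel_measurable (\<Pi>\<^sub>M i\<in>\<Lambda>. lborel)" .
  moreover have "f (?r x) = f x" for x
    using assms(2) unfolding depends_only_on_def by auto
  ultimately show ?thesis by simp
qed

lemma observable_measurable:
  fixes f :: "'d::finite config \<Rightarrow> real"
  assumes "observable \<Lambda> f"
  shows "f \<in> borel_measurable (\<Pi>\<^sub>M i\<in>\<Lambda>. lborel)"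
proof (rule continuous_measurable_PiM)
  have "partials [] f = f" by simp
  then show "continuous_on UNIV f"
    using assms unfolding observable_def smooth_in_def by (metis lists.Nil)
qed (use assms in \<open>simp add: observable_def\<close>)

text \<open>Provides measurability of conditional expectations, for which a Lipschitz bound but no
  smoothness is available.\<close>

lemma Lipschitz_continuous_on:
  fixes f :: "'d::finite config \<Rightarrow> real"
  assumes "\<And>x y. \<bar>f x - f y\<bar> \<le> K * (\<Sum>k\<in>F. \<bar>x k - y k\<bar>)"
  shows "continuous_on UNIV f"
proof -
  have "(f \<longlongrightarrow> f x) (at x)" for x
  proof -
    have "continuous_on UNIV (\<lambda>y :: 'd config. y k)" for k
      by (rule continuous_on_product_coordinates)
    then have "((\<lambda>y. y k) \<longlongrightarrow> x k) (at x)" for k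
      by (auto simp: continuous_on_def)
    then have "((\<lambda>y. K * (\<Sum>k\<in>F. \<bar>y k - x k\<bar>)) \<longlongrightarrow> K * (\<Sum>k\<in>F. \<bar>x k - x k\<bar>)) (at x)"
      by (intro tendsto_intros)
    then have lim: "((\<lambda>y. K * (\<Sum>k\<in>F. \<bar>y k - x k\<bar>)) \<longlongrightarrow> 0) (at x)" by simp
    have "\<forall>\<^sub>F y in at x. norm (f y - f x) \<le> K * (\<Sum>k\<in>F. \<bar>y k - x k\<bar>)"
      by (intro always_eventually allI) (simp only: real_norm_def assms)
    from Lim_null_comparison[OF this lim] show ?thesis by (simp add: LIM_zero_iff)
  qed
  then show ?thesis by (simp add: continuous_on_def)
qed

subsection \<open>Functions of exponential growth\<close>

lemma product_sigma_finite_lborel: "product_sigma_finite (\<lambda>_. lborel :: real measure)"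
  by (simp add: product_sigma_finite_def lborel.sigma_finite_measure_axioms)

text \<open>Growth at most exponential in the l1 norm, rather than subexponential growth in the
  usual sense. For finite \<Lambda> the class is closed under sums and products, contains
  observables and exponentials of linear functions, and its members are integrable against the Gibbs
  weight, whose decay is Gaussian.\<close>

definition subexponential :: "'d site set \<Rightarrow> ('d config \<Rightarrow> real) \<Rightarrow> bool" where
  "subexponential \<Lambda> k \<longleftrightarrow> k \<in> borel_measurable (\<Pi>\<^sub>M i\<in>\<Lambda>. lborel) \<and>
     (\<exists>K\<ge>0. \<exists>c\<ge>0. \<forall>x. \<bar>k x\<bar> \<le> K * exp (c * (\<Sum>i\<in>\<Lambda>. \<bar>x i\<bar>)))"

lemma subexponential_measurable:
  "subexponential \<Lambda> k \<Longrightarrow> k \<in> borel_measurable (\<Pi>\<^sub>M i\<in>\<Lambda>. lborel)"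
  by (simp add: subexponential_def)

lemma subexponential_bounded_by:
  assumes "subexponential \<Lambda> k" "k' \<in> borel_measurable (\<Pi>\<^sub>M i\<in>\<Lambda>. lborel)" "\<And>x. \<bar>k' x\<bar> \<le> \<bar>k x\<bar>"
  shows "subexponential \<Lambda> k'"
  using assms unfolding subexponential_def by (meson order_trans)

lemma subexponential_const: "subexponential \<Lambda> (\<lambda>x. c)"
  unfolding subexponential_def by (intro conjI exI[of _ "\<bar>c\<bar>"] exI[of _ 0]) auto

lemma subexponential_mult:
  assumes "subexponential \<Lambda> f" "subexponential \<Lambda> g"
  shows "subexponential \<Lambda> (\<lambda>x. f x * g x)"
proof -
  let ?S = "\<lambda>x. \<Sum>i\<in>\<Lambda>. \<bar>x i\<bar>"
  obtain K c K' c' where K: "K \<ge> 0" "c \<ge> 0" "K' \<ge> 0" "c' \<ge> 0"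
    and b: "\<And>x. \<bar>f x\<bar> \<le> K * exp (c * ?S x)" "\<And>x. \<bar>g x\<bar> \<le> K' * exp (c' * ?S x)"
    using assms unfolding subexponential_def by metis
  have "\<bar>f x * g x\<bar> \<le> (K * K') * exp ((c + c') * ?S x)" for x
    using mult_mono[OF b(1)[of x] b(2)[of x]] K
    by (simp add: abs_mult ring_distribs exp_add mult_ac)
  then show ?thesis using assms K unfolding subexponential_def
    by (intro conjI exI[of _ "K * K'"] exI[of _ "c + c'"]) (auto simp: add_nonneg_nonneg)
qed

lemma subexponential_add:
  assumes "subexponential \<Lambda> f" "subexponential \<Lambda> g"
  shows "subexponential \<Lambda> (\<lambda>x. f x + g x)"
proof -
  let ?S = "\<lambda>x. \<Sum>i\<in>\<Lambda>. \<bar>x i\<bar>"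
  obtain K c K' c' where K: "K \<ge> 0" "c \<ge> 0" "K' \<ge> 0" "c' \<ge> 0"
    and b: "\<And>x. \<bar>f x\<bar> \<le> K * exp (c * ?S x)" "\<And>x. \<bar>g x\<bar> \<le> K' * exp (c' * ?S x)"
    using assms unfolding subexponential_def by metis
  have "\<bar>f x + g x\<bar> \<le> (K + K') * exp ((c + c') * ?S x)" for x
  proof -
    have S: "?S x \<ge> 0" by (simp add: sum_nonneg)
    have "K * exp (c * ?S x) \<le> K * exp ((c + c') * ?S x)"
      "K' * exp (c' * ?S x) \<le> K' * exp ((c + c') * ?S x)"
      using K S by (auto intro!: mult_left_mono mult_right_mono)
    then show ?thesis using b(1)[of x] b(2)[of x] abs_triangle_ineq[of "f x" "g x"]
      unfolding ring_distribs by linarith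
  qed
  then show ?thesis using assms K unfolding subexponential_def
    by (intro conjI exI[of _ "K + K'"] exI[of _ "c + c'"]) (auto simp: add_nonneg_nonneg)
qed

lemma subexponential_diff:
  assumes "subexponential \<Lambda> f" "subexponential \<Lambda> g"
  shows "subexponential \<Lambda> (\<lambda>x. f x - g x)"
  using subexponential_add[OF assms(1) subexponential_mult[OF subexponential_const[of \<Lambda> "-1"] assms(2)]]
  by simp

lemma subexponential_sum:
  assumes "\<And>i. i \<in> I \<Longrightarrow> subexponential \<Lambda> (f i)"
  shows "subexponential \<Lambda> (\<lambda>x. \<Sum>i\<in>I. f i x)"
  using assms
  by (induction I rule: infinite_finite_induct) (auto intro: subexponential_const subexponential_add)

lemma subexponential_abs: "subexponential \<Lambda> f \<Longrightarrow> subexponential \<Lambda> (\<lambda>x. \<bar>f x\<bar>)"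
  by (rule subexponential_bounded_by[where k = f]) (auto simp: subexponential_def)

lemma subexponential_exp:
  assumes "h \<in> borel_measurable (\<Pi>\<^sub>M i\<in>\<Lambda>. lborel)" "c \<ge> 0" "\<And>x. \<bar>h x\<bar> \<le> c * (\<Sum>i\<in>\<Lambda>. \<bar>x i\<bar>)"
  shows "subexponential \<Lambda> (\<lambda>x. exp (h x))"
  unfolding subexponential_def
proof
  show "(\<lambda>x. exp (h x)) \<in> borel_measurable (\<Pi>\<^sub>M i\<in>\<Lambda>. lborel)" using assms(1) by simp
  have "\<bar>exp (h x)\<bar> \<le> 1 * exp (c * (\<Sum>i\<in>\<Lambda>. \<bar>x i\<bar>))" for x
    using assms(3)[of x] by auto
  then show "\<exists>K\<ge>0. \<exists>c\<ge>0. \<forall>x. \<bar>exp (h x)\<bar> \<le> K * exp (c * (\<Sum>i\<in>\<Lambda>. \<bar>x i\<bar>))"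
    using assms(2) zero_le_one by blast
qed

lemma subexponential_coordinate:
  assumes "finite \<Lambda>" "i \<in> \<Lambda>"
  shows "subexponential \<Lambda> (\<lambda>x. x i)"
  unfolding subexponential_def
proof (intro conjI exI[of _ 1] allI)
  fix x :: "'a config"
  have "\<bar>x i\<bar> \<le> (\<Sum>i\<in>\<Lambda>. \<bar>x i\<bar>)" using assms by (intro member_le_sum) auto
  also have "\<dots> \<le> exp (\<Sum>i\<in>\<Lambda>. \<bar>x i\<bar>)" using exp_ge_add_one_self[of "\<Sum>i\<in>\<Lambda>. \<bar>x i\<bar>"] by linarith
  finally show "\<bar>x i\<bar> \<le> 1 * exp (1 * (\<Sum>i\<in>\<Lambda>. \<bar>x i\<bar>))" by simp
qed (use assms coordinate_measurable in auto)

lemmas subexponential_intros =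
  subexponential_const subexponential_add subexponential_diff subexponential_mult
  subexponential_sum subexponential_abs subexponential_coordinate

lemma subexponential_Lipschitz:
  assumes "finite \<Lambda>" "F \<subseteq> \<Lambda>" "f \<in> borel_measurable (\<Pi>\<^sub>M i\<in>\<Lambda>. lborel)"
    and "\<And>x. \<bar>f x - f m\<bar> \<le> K * (\<Sum>k\<in>F. \<bar>x k - m k\<bar>)"
  shows "subexponential \<Lambda> f"
proof (rule subexponential_bounded_by)
  show "subexponential \<Lambda> (\<lambda>x. \<bar>f m\<bar> + \<bar>K * (\<Sum>k\<in>F. \<bar>x k - m k\<bar>)\<bar>)"
    using assms(1,2)
    by (intro subexponential_intros) auto
  show "\<bar>f x\<bar> \<le> \<bar>\<bar>f m\<bar> + \<bar>K * (\<Sum>k\<in>F. \<bar>x k - m k\<bar>)\<bar>\<bar>" for x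
    using assms(4)[of x] by linarith
qed fact

lemma subexponential_observable:
  fixes f :: "'d::finite config \<Rightarrow> real"
  assumes "finite \<Lambda>" "observable \<Lambda> f"
  shows "subexponential \<Lambda> f"
  by (rule subexponential_Lipschitz[OF assms(1), where F = "supp f" and m = "\<lambda>_. 0" and K = "grad_sup_norm \<Lambda> f"])
     (use assms observable_Lipschitz[OF assms, of _ "\<lambda>_. 0"] observable_measurable[OF assms(2)]
        supp_subset[of f \<Lambda>] in \<open>auto simp: observable_def\<close>)

text \<open>Half of the quadratic term absorbs \<open>b * \<bar>r\<bar>\<close> at the cost
  \<open>b\<^sup>2 / (2 * a)\<close> by completing the square; the other half is a Gaussian of
  variance \<open>1 / a\<close>, and \<open>K\<close> cancels its normalization.\<close>

lemma integrable_exp_abs_minus_square: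
  assumes "a > 0"
  shows "integrable lborel (\<lambda>r::real. exp (c + b * \<bar>r\<bar> - a * r\<^sup>2))"
proof (rule Bochner_Integration.integrable_bound)
  define \<sigma> where "\<sigma> = 1 / sqrt a"
  have \<sigma>: "\<sigma> > 0" "\<sigma>\<^sup>2 = 1 / a" using assms by (auto simp: \<sigma>_def power_divide)
  define K where "K = exp (c + b\<^sup>2 / (2 * a)) * sqrt (2 * pi * \<sigma>\<^sup>2)"
  show "integrable lborel (\<lambda>r. K * normal_density 0 \<sigma> r)"
    using integrable_normal_density[OF \<sigma>(1)] by simp
  have "exp (c + b * \<bar>r\<bar> - a * r\<^sup>2) \<le> K * normal_density 0 \<sigma> r" for r
  proof -
    have "0 \<le> (a * \<bar>r\<bar> - b)\<^sup>2 / (2 * a)" using assms by simp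
    also have "\<dots> = a * r\<^sup>2 / 2 + b\<^sup>2 / (2 * a) - b * \<bar>r\<bar>"
      using assms by (simp add: power2_eq_square field_simps)
    finally have "c + b * \<bar>r\<bar> - a * r\<^sup>2 \<le> (c + b\<^sup>2 / (2 * a)) + - (a * r\<^sup>2 / 2)" by linarith
    then have "exp (c + b * \<bar>r\<bar> - a * r\<^sup>2) \<le> exp (c + b\<^sup>2 / (2 * a)) * exp (- (a * r\<^sup>2 / 2))"
      by (simp flip: exp_add)
    also have "\<dots> = K * normal_density 0 \<sigma> r"
      using \<sigma> assms by (simp add: K_def normal_density_def)
    finally show ?thesis .
  qed
  then show "AE r in lborel. norm (exp (c + b * \<bar>r\<bar> - a * r\<^sup>2)) \<le> norm (K * normal_density 0 \<sigma> r)"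
    by (intro AE_I2) (smt (verit) norm_ge_zero exp_ge_zero real_norm_def)
qed simp

subsection \<open>The Hamiltonian and its Gibbs measures\<close>

text \<open>The boundary condition acts on the spins in \<Lambda> only through these numbers, which
  shift the external field \<open>s i\<close> by twice their value.\<close>

definition boundary_field :: "('d site \<Rightarrow> 'd site \<Rightarrow> real) \<Rightarrow> 'd site set \<Rightarrow> 'd config \<Rightarrow> 'd site \<Rightarrow> real" where
  "boundary_field M \<Lambda> \<omega> i = (\<Sum>\<^sub>\<infinity>j\<in>-\<Lambda>. M i j * \<omega> j)"

text \<open>A constant factor can be taken out of an \<open>infsum\<close> even when the series
  diverges, where the value is 0 by default. So the formula is available for every \<omega>.\<close>

lemma hamiltonian_eq:
  "hamiltonian \<psi> s M \<Lambda> \<omega> x =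
     (\<Sum>i\<in>\<Lambda>. \<psi> i (x i) + (s i + 2 * boundary_field M \<Lambda> \<omega> i) * x i) + (\<Sum>i\<in>\<Lambda>. \<Sum>j\<in>\<Lambda>. M i j * x i * x j)"
proof -
  have "(\<Sum>\<^sub>\<infinity>j\<in>-\<Lambda>. M i j * x i * \<omega> j) = boundary_field M \<Lambda> \<omega> i * x i" for i
    unfolding boundary_field_def
    by (subst infsum_cmult_left'[symmetric]) (simp add: mult_ac)
  then show ?thesis
    by (simp add: hamiltonian_def sum.distrib sum_distrib_left ring_distribs mult_ac)
qed

lemma abs_mult_le_half_sum_squares: "\<bar>a * b\<bar> \<le> (a\<^sup>2 + b\<^sup>2) / 2" for a b :: real
  using sum_squares_bound[of "\<bar>a\<bar>" "\<bar>b\<bar>"] by (simp add: abs_mult)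

text \<open>\<open>M_summable\<close> makes the sum in \<open>M_dominant\<close> a genuine one, as a
  divergent \<open>infsum\<close> would be 0. The power decay of \<open>M\<close> is kept out of the
  locale and is supplied where correlations are summed over the volume.\<close>

locale spin_system =
  fixes \<psi> \<psi>b \<psi>c :: "'d::finite site \<Rightarrow> real \<Rightarrow> real"
    and s :: "'d site \<Rightarrow> real"
    and M :: "'d site \<Rightarrow> 'd site \<Rightarrow> real"
    and C\<psi> \<delta> :: real
  assumes M_sym: "\<And>i j. M i j = M j i"
    and \<psi>_split: "\<And>i r. \<psi> i r = \<psi>b i r + \<psi>c i r"
    and \<psi>c_diff: "\<And>i r. \<psi>c i differentiable (at r)"
    and \<psi>c_diff2: "\<And>i r. deriv (\<psi>c i) differentiable (at r)"
    and \<psi>c_convex: "\<And>i r. deriv (deriv (\<psi>c i)) r \<ge> 0"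
    and \<psi>b_diff: "\<And>i r. \<psi>b i differentiable (at r)"
    and \<psi>b_bound: "\<And>i r. \<bar>\<psi>b i r\<bar> + \<bar>deriv (\<psi>b i) r\<bar> \<le> C\<psi>"
    and \<delta>_pos: "\<delta> > 0"
    and M_summable: "\<And>i. (\<lambda>j. \<bar>M i j\<bar>) summable_on (- {i})"
    and M_dominant: "\<And>i. \<delta> + (\<Sum>\<^sub>\<infinity>j\<in>-{i}. \<bar>M i j\<bar>) \<le> M i i"
begin

abbreviation H :: "'d site set \<Rightarrow> 'd config \<Rightarrow> 'd config \<Rightarrow> real" where
  "H \<equiv> hamiltonian \<psi> s M"

abbreviation Z :: "'d site set \<Rightarrow> 'd config \<Rightarrow> real" where
  "Z \<equiv> partition_function \<psi> s M"

abbreviation \<mu> :: "'d site set \<Rightarrow> 'd config \<Rightarrow> 'd config measure" where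
  "\<mu> \<equiv> gibbs \<psi> s M"

abbreviation P :: "'d site set \<Rightarrow> 'd config measure" where
  "P \<Lambda> \<equiv> (\<Pi>\<^sub>M i\<in>\<Lambda>. lborel)"

section \<open>Convex potentials and coercivity of the energy\<close>

lemma \<psi>c_convex_on: "convex_on UNIV (\<psi>c i)"
proof (rule f''_ge0_imp_convex)
  show "(\<psi>c i has_real_derivative deriv (\<psi>c i) r) (at r)"
    "(deriv (\<psi>c i) has_real_derivative deriv (deriv (\<psi>c i)) r) (at r)" for r
    using \<psi>c_diff \<psi>c_diff2 by (auto simp: DERIV_deriv_iff_real_differentiable)
qed (use \<psi>c_convex in auto)

lemma \<psi>c_tangent: "\<psi>c i r + deriv (\<psi>c i) r * (w - r) \<le> \<psi>c i w"
  using convex_on_imp_above_tangent[OF \<psi>c_convex_on[of i], of r w "deriv (\<psi>c i) r"] \<psi>c_diff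
  by (auto simp: DERIV_deriv_iff_real_differentiable)

lemma \<psi>b_Lipschitz: "\<bar>\<psi>b i w - \<psi>b i r\<bar> \<le> C\<psi> * \<bar>w - r\<bar>"
proof -
  have "\<bar>deriv (\<psi>b i) r\<bar> \<le> C\<psi>" for r using \<psi>b_bound[of i r] by linarith
  moreover have "(\<psi>b i has_real_derivative deriv (\<psi>b i) r) (at r)" for r
    using \<psi>b_diff by (auto simp: DERIV_deriv_iff_real_differentiable)
  ultimately have "norm (\<psi>b i w - \<psi>b i r) \<le> C\<psi> * norm (w - r)"
    by (intro field_differentiable_bound[of UNIV _ "deriv (\<psi>b i)"]) auto
  then show ?thesis by simp
qed

text \<open>The tangent of the convex part at 0 gives a bound with linear growth; confinement is
  left to the quadratic form.\<close>

lemma \<psi>_lower: "\<psi> i r \<ge> - (C\<psi> + \<bar>\<psi>c i 0\<bar>) - \<bar>deriv (\<psi>c i) 0\<bar> * \<bar>r\<bar>"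
proof -
  have "\<bar>\<psi>b i r\<bar> \<le> C\<psi>" using \<psi>b_bound[of i r] by linarith
  moreover have "- (\<bar>deriv (\<psi>c i) 0\<bar> * \<bar>r\<bar>) \<le> deriv (\<psi>c i) 0 * r"
    by (metis abs_le_D2 abs_mult minus_le_iff order_refl)
  ultimately show ?thesis using \<psi>c_tangent[of i 0 r] by (simp add: \<psi>_split)
qed

lemma row_sum_le:
  assumes "finite \<Lambda>"
  shows "(\<Sum>j\<in>\<Lambda> - {i}. \<bar>M i j\<bar>) \<le> M i i - \<delta>"
proof -
  have "(\<Sum>j\<in>\<Lambda> - {i}. \<bar>M i j\<bar>) \<le> (\<Sum>\<^sub>\<infinity>j\<in>-{i}. \<bar>M i j\<bar>)"
    by (intro finite_sum_le_infsum M_summable) (use assms in auto)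
  then show ?thesis using M_dominant[of i] by linarith
qed

text \<open>Young's inequality splits each off-diagonal term evenly between its two sites. By
  symmetry of \<open>M\<close> each site then pays one full row sum, which diagonal dominance bounds
  by \<open>M i i - \<delta>\<close>.\<close>

lemma quadratic_form_ge:
  assumes "finite \<Lambda>"
  shows "(\<Sum>i\<in>\<Lambda>. \<Sum>j\<in>\<Lambda>. M i j * x i * x j) \<ge> \<delta> * (\<Sum>i\<in>\<Lambda>. (x i)\<^sup>2)"
proof -
  let ?o = "\<lambda>i j. if j = i then 0 else \<bar>M i j\<bar>"
  have o: "(\<Sum>j\<in>\<Lambda>. ?o i j) \<le> M i i - \<delta>" if "i \<in> \<Lambda>" for i
  proof -
    have "(\<Sum>j\<in>\<Lambda>. ?o i j) = (\<Sum>j\<in>\<Lambda> - {i}. \<bar>M i j\<bar>)"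
      using assms that by (simp add: sum.remove[of \<Lambda> i])
    then show ?thesis using row_sum_le[OF assms] by simp
  qed
  have pw: "M i j * x i * x j \<ge> (if j = i then M i i * (x i)\<^sup>2 else 0) - ?o i j * (x i)\<^sup>2 / 2 - ?o i j * (x j)\<^sup>2 / 2" for i j
  proof (cases "j = i")
    case False
    have "- (M i j * (x i * x j)) \<le> \<bar>M i j\<bar> * \<bar>x i * x j\<bar>" by (metis abs_ge_minus_self abs_mult)
    also have "\<dots> \<le> \<bar>M i j\<bar> * (((x i)\<^sup>2 + (x j)\<^sup>2) / 2)"
      by (intro mult_left_mono abs_mult_le_half_sum_squares) auto
    finally show ?thesis using False by (simp add: ring_distribs mult.assoc add_divide_distrib)
  qed (simp add: power2_eq_square)
  have "\<delta> * (\<Sum>i\<in>\<Lambda>. (x i)\<^sup>2) \<le> (\<Sum>i\<in>\<Lambda>. M i i * (x i)\<^sup>2 - (\<Sum>j\<in>\<Lambda>. ?o i j) * (x i)\<^sup>2)"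
    unfolding sum_distrib_left using o
    by (intro sum_mono) (smt (verit) mult_right_mono left_diff_distrib zero_le_power2)
  also have "\<dots> = (\<Sum>i\<in>\<Lambda>. M i i * (x i)\<^sup>2) - (\<Sum>i\<in>\<Lambda>. \<Sum>j\<in>\<Lambda>. ?o i j * (x i)\<^sup>2 / 2) - (\<Sum>i\<in>\<Lambda>. \<Sum>j\<in>\<Lambda>. ?o i j * (x i)\<^sup>2 / 2)"
    by (simp add: sum_subtractf sum_distrib_right flip: sum_divide_distrib)
  also have "(\<Sum>i\<in>\<Lambda>. M i i * (x i)\<^sup>2) = (\<Sum>i\<in>\<Lambda>. \<Sum>j\<in>\<Lambda>. if j = i then M i i * (x i)\<^sup>2 else 0)"
    using assms by (simp add: sum.delta)
  moreover have "(\<Sum>i\<in>\<Lambda>. \<Sum>j\<in>\<Lambda>. ?o i j * (x i)\<^sup>2 / 2) = (\<Sum>i\<in>\<Lambda>. \<Sum>j\<in>\<Lambda>. ?o i j * (x j)\<^sup>2 / 2)"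
    by (subst sum.swap) (intro sum.cong refl, auto simp: M_sym)
  ultimately have le: "\<delta> * (\<Sum>i\<in>\<Lambda>. (x i)\<^sup>2) \<le> (\<Sum>i\<in>\<Lambda>. \<Sum>j\<in>\<Lambda>. if j = i then M i i * (x i)\<^sup>2 else 0)
     - (\<Sum>i\<in>\<Lambda>. \<Sum>j\<in>\<Lambda>. ?o i j * (x j)\<^sup>2 / 2) - (\<Sum>i\<in>\<Lambda>. \<Sum>j\<in>\<Lambda>. ?o i j * (x i)\<^sup>2 / 2)" by linarith
  show ?thesis
    apply (rule order_trans[OF le])
    unfolding sum_subtractf[symmetric]
    using pw by (intro sum_mono) (smt (verit))
qed

lemma \<psi>_measurable [measurable]: "\<psi> i \<in> borel_measurable borel"
proof (rule borel_measurable_continuous_onI)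
  have "isCont (\<psi>b i) r" "isCont (\<psi>c i) r" for r
    using \<psi>b_diff \<psi>c_diff by (auto intro: differentiable_imp_continuous_within)
  then show "continuous_on UNIV (\<psi> i)"
    by (auto simp: \<psi>_split[abs_def] intro!: continuous_at_imp_continuous_on continuous_intros)
qed

lemma H_measurable: "H \<Lambda> \<omega> \<in> borel_measurable (P \<Lambda>)"
  unfolding hamiltonian_eq[abs_def]
  by (intro borel_measurable_add borel_measurable_sum borel_measurable_times borel_measurable_const
      measurable_compose[OF coordinate_measurable \<psi>_measurable] coordinate_measurable)

text \<open>The bound is a sum over sites, so that \<open>exp (- H)\<close> is dominated by a
  product of one-dimensional functions with Gaussian decay.\<close>

lemma H_lower:
  assumes "finite \<Lambda>"
  obtains a b where "\<And>x. H \<Lambda> \<omega> x \<ge> (\<Sum>i\<in>\<Lambda>. \<delta> * (x i)\<^sup>2 - b i * \<bar>x i\<bar> - a i)"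
proof
  let ?h = "\<lambda>i. s i + 2 * boundary_field M \<Lambda> \<omega> i"
  let ?b = "\<lambda>i. \<bar>deriv (\<psi>c i) 0\<bar> + \<bar>?h i\<bar>"
  let ?a = "\<lambda>i. C\<psi> + \<bar>\<psi>c i 0\<bar>"
  fix x
  have "- (?b i * \<bar>x i\<bar>) - ?a i \<le> \<psi> i (x i) + ?h i * x i" for i
  proof -
    have "- (\<bar>?h i\<bar> * \<bar>x i\<bar>) \<le> ?h i * x i"
      by (metis abs_le_D2 abs_mult minus_le_iff order_refl)
    then show ?thesis using \<psi>_lower[of i "x i"] unfolding ring_distribs by linarith
  qed
  then have "(\<Sum>i\<in>\<Lambda>. - (?b i * \<bar>x i\<bar>) - ?a i) \<le> (\<Sum>i\<in>\<Lambda>. \<psi> i (x i) + ?h i * x i)"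
    by (intro sum_mono)
  moreover have "(\<Sum>i\<in>\<Lambda>. \<delta> * (x i)\<^sup>2 - ?b i * \<bar>x i\<bar> - ?a i)
      = \<delta> * (\<Sum>i\<in>\<Lambda>. (x i)\<^sup>2) + (\<Sum>i\<in>\<Lambda>. - (?b i * \<bar>x i\<bar>) - ?a i)"
    by (simp add: sum_distrib_left algebra_simps flip: sum.distrib)
  ultimately show "H \<Lambda> \<omega> x \<ge> (\<Sum>i\<in>\<Lambda>. \<delta> * (x i)\<^sup>2 - ?b i * \<bar>x i\<bar> - ?a i)"
    unfolding hamiltonian_eq using quadratic_form_ge[OF assms, of x] by linarith
qed

section \<open>Integrability and normalization of the Gibbs weight\<close>

lemma integrable_exp_H_mult:
  assumes "finite \<Lambda>" "subexponential \<Lambda> k"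
  shows "integrable (P \<Lambda>) (\<lambda>x. exp (- H \<Lambda> \<omega> x) * k x)"
proof -
  obtain K c where K: "K \<ge> 0" and k: "\<And>x. \<bar>k x\<bar> \<le> K * exp (c * (\<Sum>i\<in>\<Lambda>. \<bar>x i\<bar>))"
    using assms(2) unfolding subexponential_def by metis
  obtain a b where ab: "\<And>x. H \<Lambda> \<omega> x \<ge> (\<Sum>i\<in>\<Lambda>. \<delta> * (x i)\<^sup>2 - b i * \<bar>x i\<bar> - a i)"
    using H_lower[OF assms(1)] by blast
  \<comment> \<open>The product of the site-wise bounds, with the growth rate \<open>c\<close> of
    \<open>k\<close> added to each \<open>b i\<close>.\<close>
  let ?g = "\<lambda>x. K * (\<Prod>i\<in>\<Lambda>. exp (a i + (b i + c) * \<bar>x i\<bar> - \<delta> * (x i)\<^sup>2))"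
  interpret product_sigma_finite "\<lambda>_. lborel :: real measure" by (rule product_sigma_finite_lborel)
  have "integrable (P \<Lambda>) ?g"
    by (intro integrable_mult_right product_integrable_prod assms integrable_exp_abs_minus_square \<delta>_pos)
  then show ?thesis
  proof (rule Bochner_Integration.integrable_bound)
    show "(\<lambda>x. exp (- H \<Lambda> \<omega> x) * k x) \<in> borel_measurable (P \<Lambda>)"
      using H_measurable subexponential_measurable[OF assms(2)] by measurable
    have "\<bar>exp (- H \<Lambda> \<omega> x) * k x\<bar> \<le> \<bar>?g x\<bar>" for x
    proof -
      have "\<bar>exp (- H \<Lambda> \<omega> x) * k x\<bar> \<le> exp (- (\<Sum>i\<in>\<Lambda>. \<delta> * (x i)\<^sup>2 - b i * \<bar>x i\<bar> - a i)) * (K * exp (c * (\<Sum>i\<in>\<Lambda>. \<bar>x i\<bar>)))"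
        unfolding abs_mult using ab[of x] k[of x] K by (intro mult_mono) auto
      also have "\<dots> = K * exp (\<Sum>i\<in>\<Lambda>. a i + (b i + c) * \<bar>x i\<bar> - \<delta> * (x i)\<^sup>2)"
        by (simp add: sum.distrib sum_subtractf ring_distribs sum_distrib_left flip: exp_add)
      also have "\<dots> = ?g x" by (simp add: exp_sum assms)
      finally show ?thesis by linarith
    qed
    then show "AE x in P \<Lambda>. norm (exp (- H \<Lambda> \<omega> x) * k x) \<le> norm (?g x)" by simp
  qed
qed

lemma integrable_exp_H: "finite \<Lambda> \<Longrightarrow> integrable (P \<Lambda>) (\<lambda>x. exp (- H \<Lambda> \<omega> x))"
  using integrable_exp_H_mult[OF _ subexponential_const[of \<Lambda> 1]] by simp

text \<open>If the integral of the strictly positive weight vanished, the product Lebesgue measure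
  would be null.\<close>

lemma Z_pos:
  assumes "finite \<Lambda>"
  shows "Z \<Lambda> \<omega> > 0"
proof -
  interpret product_sigma_finite "\<lambda>_. lborel :: real measure" by (rule product_sigma_finite_lborel)
  have ne: "emeasure (P \<Lambda>) (space (P \<Lambda>)) \<noteq> 0"
    using emeasure_PiM[OF assms, of "\<lambda>_. UNIV"] assms by (auto simp: space_PiM)
  have "Z \<Lambda> \<omega> \<noteq> 0"
  proof
    assume "Z \<Lambda> \<omega> = 0"
    then have "AE x in P \<Lambda>. exp (- H \<Lambda> \<omega> x) = 0"
      using integral_nonneg_eq_0_iff_AE[OF integrable_exp_H[OF assms, of \<omega>]]
      by (simp add: partition_function_def)
    then have "AE x in P \<Lambda>. False" by simp
    then show False using ne by (simp add: AE_iff_null_sets null_setsD1)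
  qed
  moreover have "Z \<Lambda> \<omega> \<ge> 0" unfolding partition_function_def by simp
  ultimately show ?thesis by simp
qed

lemma gibbs_weight_measurable: "(\<lambda>x. exp (- H \<Lambda> \<omega> x) / Z \<Lambda> \<omega>) \<in> borel_measurable (P \<Lambda>)"
  using H_measurable by measurable

lemma integral_gibbs:
  assumes "finite \<Lambda>" "k \<in> borel_measurable (P \<Lambda>)"
  shows "(\<integral>x. k x \<partial>\<mu> \<Lambda> \<omega>) = (\<integral>x. exp (- H \<Lambda> \<omega> x) * k x \<partial>P \<Lambda>) / Z \<Lambda> \<omega>"
proof -
  have "(\<integral>x. k x \<partial>\<mu> \<Lambda> \<omega>) = (\<integral>x. exp (- H \<Lambda> \<omega> x) / Z \<Lambda> \<omega> * k x \<partial>P \<Lambda>)"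
    unfolding gibbs_def using Z_pos[OF assms(1), of \<omega>]
    by (subst integral_density[OF assms(2) gibbs_weight_measurable]) auto
  then show ?thesis by simp
qed

lemma integrable_gibbs:
  assumes "finite \<Lambda>" "subexponential \<Lambda> k"
  shows "integrable (\<mu> \<Lambda> \<omega>) k"
proof -
  have "integrable (P \<Lambda>) (\<lambda>x. (1 / Z \<Lambda> \<omega>) * (exp (- H \<Lambda> \<omega> x) * k x))"
    by (intro integrable_mult_right integrable_exp_H_mult assms)
  then show ?thesis
    unfolding gibbs_def using Z_pos[OF assms(1), of \<omega>] subexponential_measurable[OF assms(2)]
    by (subst integrable_density[OF _ gibbs_weight_measurable]) auto
qed

lemma prob_space_gibbs:
  assumes "finite \<Lambda>"
  shows "prob_space (\<mu> \<Lambda> \<omega>)"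
proof
  have "emeasure (\<mu> \<Lambda> \<omega>) (space (\<mu> \<Lambda> \<omega>)) = (\<integral>\<^sup>+x. ennreal (exp (- H \<Lambda> \<omega> x) / Z \<Lambda> \<omega>) \<partial>P \<Lambda>)"
    unfolding gibbs_def using gibbs_weight_measurable[of \<Lambda> \<omega>]
    by (subst emeasure_density) (auto simp: indicator_def intro!: nn_integral_cong)
  also have "\<dots> = ennreal (\<integral>x. exp (- H \<Lambda> \<omega> x) / Z \<Lambda> \<omega> \<partial>P \<Lambda>)"
    using Z_pos[OF assms, of \<omega>] integrable_exp_H[OF assms, of \<omega>]
    by (intro nn_integral_eq_integral) auto
  also have "\<dots> = 1" using Z_pos[OF assms, of \<omega>] by (simp add: partition_function_def)
  finally show "emeasure (\<mu> \<Lambda> \<omega>) (space (\<mu> \<Lambda> \<omega>)) = 1" .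
qed

text \<open>Fubini isolates the coordinate \<open>i\<close>, where an affine substitution
  contributes the Jacobian. Formulated for nonnegative integrals, the identity yields integrability
  of the contracted weight instead of requiring it.\<close>

lemma nn_integral_contract_coordinate:
  assumes "finite \<Lambda>" "i \<in> \<Lambda>" "\<theta> < 1" "f \<in> borel_measurable (P \<Lambda>)"
  shows "(\<integral>\<^sup>+x. f x \<partial>P \<Lambda>) = ennreal (1 - \<theta>) * (\<integral>\<^sup>+x. f (x(i := (1 - \<theta>) * x i + \<theta> * m)) \<partial>P \<Lambda>)"
proof -
  interpret product_sigma_finite "\<lambda>_. lborel :: real measure" by (rule product_sigma_finite_lborel)
  define I where "I = \<Lambda> - {i}"
  have I: "finite I" "i \<notin> I" "\<Lambda> = insert i I" using assms by (auto simp: I_def)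
  let ?T = "\<lambda>x. x(i := (1 - \<theta>) * x i + \<theta> * m)"
  have T: "?T \<in> measurable (P \<Lambda>) (P \<Lambda>)"
    by (intro measurable_fun_upd[where J = \<Lambda>]) (use assms coordinate_measurable[of i \<Lambda>] in auto)
  have sect: "(\<lambda>y. f (x(i := y))) \<in> borel_measurable lborel" if "x \<in> space (P I)" for x
  proof (rule measurable_compose[OF _ assms(4)])
    show "(\<lambda>y. x(i := y)) \<in> measurable lborel (P \<Lambda>)"
      unfolding I(3) using that I(2)
      by (intro measurable_component_update) auto
  qed
  have fT: "(\<lambda>x. f (?T x)) \<in> borel_measurable (P \<Lambda>)" by (rule measurable_compose[OF T assms(4)])
  have "(\<integral>\<^sup>+x. f x \<partial>P \<Lambda>) = (\<integral>\<^sup>+x. \<integral>\<^sup>+y. f (x(i := y)) \<partial>lborel \<partial>P I)"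
    using product_nn_integral_insert[OF I(1,2), of f] assms(4) by (simp add: I(3))
  also have "\<dots> = (\<integral>\<^sup>+x. \<integral>\<^sup>+y. ennreal (1 - \<theta>) * f (?T (x(i := y))) \<partial>lborel \<partial>P I)"
  proof (rule nn_integral_cong)
    fix x assume x: "x \<in> space (P I)"
    have "(\<lambda>y. f (?T (x(i := y)))) \<in> borel_measurable lborel"
      using measurable_compose[OF _ sect[OF x], of "\<lambda>y. (1 - \<theta>) * y + \<theta> * m" lborel] by simp
    then show "(\<integral>\<^sup>+y. f (x(i := y)) \<partial>lborel) = (\<integral>\<^sup>+y. ennreal (1 - \<theta>) * f (?T (x(i := y))) \<partial>lborel)"
      using nn_integral_real_affine[of "\<lambda>y. f (x(i := y))" "1 - \<theta>" "\<theta> * m"] sect[OF x] assms(3)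
      by (simp add: nn_integral_cmult add.commute)
  qed
  also have "\<dots> = (\<integral>\<^sup>+x. ennreal (1 - \<theta>) * f (?T x) \<partial>P \<Lambda>)"
    using product_nn_integral_insert[OF I(1,2), of "\<lambda>x. ennreal (1 - \<theta>) * f (?T x)"] fT by (simp add: I(3))
  also have "\<dots> = ennreal (1 - \<theta>) * (\<integral>\<^sup>+x. f (?T x) \<partial>P \<Lambda>)"
    by (rule nn_integral_cmult[OF fT])
  finally show ?thesis .
qed

end

subsection \<open>The uniform variance bound\<close>

lemma quadratic_form_update:
  fixes A :: "'a \<Rightarrow> 'a \<Rightarrow> real"
  assumes "finite \<Lambda>" "i \<in> \<Lambda>" "\<And>k l. A k l = A l k"
  shows "(\<Sum>k\<in>\<Lambda>. \<Sum>l\<in>\<Lambda>. A k l * (x(i := x i + v)) k * (x(i := x i + v)) l)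
    = (\<Sum>k\<in>\<Lambda>. \<Sum>l\<in>\<Lambda>. A k l * x k * x l) + 2 * v * (\<Sum>l\<in>\<Lambda>. A i l * x l) + v\<^sup>2 * A i i"
proof -
  \<comment> \<open>The update is the addition of a vector supported at \<open>i\<close>; the four
    summands below are the bilinear expansion.\<close>
  let ?d = "\<lambda>k. if k = i then v else 0"
  have "(\<Sum>k\<in>\<Lambda>. \<Sum>l\<in>\<Lambda>. A k l * (x(i := x i + v)) k * (x(i := x i + v)) l)
     = (\<Sum>k\<in>\<Lambda>. \<Sum>l\<in>\<Lambda>. A k l * x k * x l + ?d k * (A k l * x l) + ?d l * (A k l * x k) + ?d l * (?d k * A k l))"
    by (intro sum.cong refl) (auto simp: algebra_simps)
  also have "\<dots> = (\<Sum>k\<in>\<Lambda>. \<Sum>l\<in>\<Lambda>. A k l * x k * x l) + (\<Sum>k\<in>\<Lambda>. ?d k * (\<Sum>l\<in>\<Lambda>. A k l * x l))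
      + (\<Sum>k\<in>\<Lambda>. \<Sum>l\<in>\<Lambda>. ?d l * (A k l * x k)) + (\<Sum>k\<in>\<Lambda>. \<Sum>l\<in>\<Lambda>. ?d l * (?d k * A k l))"
    by (simp add: sum.distrib sum_distrib_left)
  also have "(\<Sum>k\<in>\<Lambda>. ?d k * (\<Sum>l\<in>\<Lambda>. A k l * x l)) = v * (\<Sum>l\<in>\<Lambda>. A i l * x l)"
    using assms by (simp add: if_distrib[of "\<lambda>c. c * _"] cong: if_cong)
  also have "(\<Sum>k\<in>\<Lambda>. \<Sum>l\<in>\<Lambda>. ?d l * (A k l * x k)) = v * (\<Sum>l\<in>\<Lambda>. A i l * x l)"
    using assms by (simp add: if_distrib[of "\<lambda>c. c * _"] sum_distrib_left cong: if_cong)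
  also have "(\<Sum>k\<in>\<Lambda>. \<Sum>l\<in>\<Lambda>. ?d l * (?d k * A k l)) = v\<^sup>2 * A i i"
    using assms by (simp add: if_distrib[of "\<lambda>c. c * _"] if_distrib[of "\<lambda>c. v * c"] power2_eq_square
        cong: if_cong)
  finally show ?thesis by (simp add: algebra_simps)
qed

context spin_system begin

text \<open>\<open>a\<close> collects the coefficients of the terms linear in
  \<open>x i - m\<close>, which integrate to 0 once \<open>m\<close> is the mean of the spin. The
  bounded part enters through its Lipschitz constant, the convex part through two convexity
  bounds.\<close>

lemma H_contract_coordinate:
  fixes m :: real and \<omega> :: "'d config"
  assumes "finite \<Lambda>" "i \<in> \<Lambda>" "0 \<le> \<theta>" "\<theta> \<le> 1"
  defines "a \<equiv> deriv (\<psi>c i) m + s i + 2 * boundary_field M \<Lambda> \<omega> i"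
  shows "H \<Lambda> \<omega> (x(i := (1 - \<theta>) * x i + \<theta> * m)) \<le> H \<Lambda> \<omega> x
    + \<theta> * (C\<psi> * \<bar>x i - m\<bar> - a * (x i - m) + \<theta> * M i i * (x i - m)\<^sup>2 - 2 * (\<Sum>j\<in>\<Lambda>. M i j * ((x i - m) * x j)))"
proof -
  let ?u = "x i - m" and ?w = "(1 - \<theta>) * x i + \<theta> * m"
  let ?h = "\<lambda>k. s k + 2 * boundary_field M \<Lambda> \<omega> k"
  let ?\<phi> = "\<lambda>k r. \<psi> k r + ?h k * r"
  have w: "?w = x i + - \<theta> * ?u" by (simp add: algebra_simps)
  have "\<bar>\<psi>b i ?w - \<psi>b i (x i)\<bar> \<le> C\<psi> * \<bar>?w - x i\<bar>" by (rule \<psi>b_Lipschitz)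
  also have "\<bar>?w - x i\<bar> = \<theta> * \<bar>?u\<bar>"
    unfolding w using assms(3) by (simp add: abs_mult)
  finally have b: "\<psi>b i ?w \<le> \<psi>b i (x i) + \<theta> * (C\<psi> * \<bar>?u\<bar>)" by (simp add: mult_ac)
  \<comment> \<open>Convexity bounds the value at the contracted point, and the tangent at
    \<open>m\<close> then turns the difference of values of \<psi>c into a linear term, so that the
    derivative of \<psi>c at \<open>x i\<close> never occurs.\<close>
  have "\<psi>c i ?w \<le> (1 - \<theta>) * \<psi>c i (x i) + \<theta> * \<psi>c i m"
    using convex_onD[OF \<psi>c_convex_on[of i], of \<theta> "x i" m] assms(3,4) by simp
  also have "\<dots> = \<psi>c i (x i) - \<theta> * (\<psi>c i (x i) - \<psi>c i m)" by (simp add: algebra_simps)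
  also have "\<dots> \<le> \<psi>c i (x i) - \<theta> * (deriv (\<psi>c i) m * ?u)"
    using \<psi>c_tangent[of i m "x i"] assms(3) by (intro diff_left_mono mult_left_mono) auto
  finally have c: "\<psi>c i ?w \<le> \<psi>c i (x i) - \<theta> * (deriv (\<psi>c i) m * ?u)" .
  have "?\<phi> i ?w = \<psi>b i ?w + \<psi>c i ?w + ?h i * x i - \<theta> * (?h i * ?u)"
    unfolding \<psi>_split by (subst (3) w) (simp add: algebra_simps)
  also have "\<dots> \<le> ?\<phi> i (x i) + \<theta> * (C\<psi> * \<bar>?u\<bar>) - \<theta> * (a * ?u)"
    using b c unfolding \<psi>_split a_def by (simp add: algebra_simps)
  finally have \<phi>: "?\<phi> i ?w \<le> ?\<phi> i (x i) + \<theta> * (C\<psi> * \<bar>?u\<bar>) - \<theta> * (a * ?u)" .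
  have "(\<Sum>k\<in>\<Lambda>. ?\<phi> k ((x(i := ?w)) k)) = ?\<phi> i ?w + (\<Sum>k\<in>\<Lambda> - {i}. ?\<phi> k (x k))"
    using assms(1,2) by (simp add: sum.remove[of \<Lambda> i])
  moreover have "(\<Sum>k\<in>\<Lambda>. ?\<phi> k (x k)) = ?\<phi> i (x i) + (\<Sum>k\<in>\<Lambda> - {i}. ?\<phi> k (x k))"
    using assms(1,2) by (simp add: sum.remove[of \<Lambda> i])
  moreover have "(\<Sum>k\<in>\<Lambda>. \<Sum>l\<in>\<Lambda>. M k l * (x(i := ?w)) k * (x(i := ?w)) l)
    = (\<Sum>k\<in>\<Lambda>. \<Sum>l\<in>\<Lambda>. M k l * x k * x l) - \<theta> * (2 * (\<Sum>j\<in>\<Lambda>. M i j * (?u * x j))) + \<theta> * (\<theta> * M i i * ?u\<^sup>2)"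
  proof -
    have "(\<Sum>j\<in>\<Lambda>. M i j * (?u * x j)) = ?u * (\<Sum>l\<in>\<Lambda>. M i l * x l)"
      by (simp add: sum_distrib_left mult_ac)
    then show ?thesis
      using quadratic_form_update[OF assms(1,2), of M x "- \<theta> * ?u", OF M_sym]
      unfolding w by (simp add: power2_eq_square mult_ac del: fun_upd_apply)
  qed
  ultimately show ?thesis
    unfolding hamiltonian_eq distrib_left[of \<theta>] right_diff_distrib[of \<theta>]
    using \<phi> by linarith
qed

text \<open>Formally, integration by parts gives
  \<open>E ((x i - m i) * \<partial>H / \<partial>x i) = 1\<close>. The convex part contributes a
  nonnegative term, since its derivative is increasing and \<open>x i - m i\<close> has mean 0, and
  the bounded part at least \<open>- C\<psi> * E \<bar>x i - m i\<bar>\<close>. The contraction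
  makes this rigorous.\<close>

lemma covariance_inequality:
  fixes \<omega> :: "'d config"
  assumes "finite \<Lambda>" "i \<in> \<Lambda>"
  defines "m \<equiv> \<lambda>k. \<integral>x. x k \<partial>\<mu> \<Lambda> \<omega>"
  shows "2 * (\<Sum>j\<in>\<Lambda>. M i j * (\<integral>x. (x i - m i) * (x j - m j) \<partial>\<mu> \<Lambda> \<omega>))
    \<le> 1 + C\<psi> * (\<integral>x. \<bar>x i - m i\<bar> \<partial>\<mu> \<Lambda> \<omega>)"
proof -
  let ?E = "\<lambda>k :: 'd config \<Rightarrow> real. \<integral>x. k x \<partial>\<mu> \<Lambda> \<omega>"
  interpret prob_space "\<mu> \<Lambda> \<omega>" by (rule prob_space_gibbs[OF assms(1)])
  define a where "a = deriv (\<psi>c i) (m i) + s i + 2 * boundary_field M \<Lambda> \<omega> i"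
  define c where "c = (\<Sum>j\<in>\<Lambda>. M i j * ?E (\<lambda>x. (x i - m i) * (x j - m j)))"
  define b where "b = C\<psi> * ?E (\<lambda>x. \<bar>x i - m i\<bar>)"
  define v where "v = M i i * ?E (\<lambda>x. (x i - m i)\<^sup>2)"
  have sub: "subexponential \<Lambda> (\<lambda>x. x j)" if "j \<in> \<Lambda>" for j
    using assms(1) that by (rule subexponential_coordinate)
  have subu: "subexponential \<Lambda> (\<lambda>x. x i - m i)" by (intro subexponential_intros sub assms)
  note int = integrable_gibbs[OF assms(1), where \<omega> = \<omega>]
  have iu: "integrable (\<mu> \<Lambda> \<omega>) (\<lambda>x. x i - m i)"
    "integrable (\<mu> \<Lambda> \<omega>) (\<lambda>x. \<bar>x i - m i\<bar>)"
    "integrable (\<mu> \<Lambda> \<omega>) (\<lambda>x. (x i - m i)\<^sup>2)"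
    unfolding power2_eq_square using subu by (auto intro!: int subexponential_intros)
  have ij: "integrable (\<mu> \<Lambda> \<omega>) (\<lambda>x. (x i - m i) * x j)" if "j \<in> \<Lambda>" for j
    using subu sub[OF that] by (auto intro!: int subexponential_intros)
  have ix: "integrable (\<mu> \<Lambda> \<omega>) (\<lambda>x. x i)" using sub[OF assms(2)] by (rule int)
  have Eu: "?E (\<lambda>x. x i - m i) = 0"
    using ix by (simp add: m_def prob_space)
  \<comment> \<open>The contraction produces \<open>x j\<close>; centring it changes nothing because
    \<open>x i - m i\<close> has mean 0.\<close>
  have Euj: "?E (\<lambda>x. (x i - m i) * x j) = ?E (\<lambda>x. (x i - m i) * (x j - m j))" if "j \<in> \<Lambda>" for j
  proof -
    have "?E (\<lambda>x. (x i - m i) * (x j - m j)) = ?E (\<lambda>x. (x i - m i) * x j - m j * (x i - m i))"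
      by (intro Bochner_Integration.integral_cong) (auto simp: algebra_simps)
    also have "\<dots> = ?E (\<lambda>x. (x i - m i) * x j) - m j * ?E (\<lambda>x. x i - m i)"
      using ij[OF that] iu(1) by simp
    finally show ?thesis using Eu by simp
  qed
  \<comment> \<open>The inequality at a fixed contraction strength: \<open>\<theta> * v\<close>
    comes from the quadratic form and vanishes in the limit, while \<open>1 / (1 - \<theta>)\<close>
    comes from the Jacobian and tends to 1.\<close>
  have main: "2 * c \<le> b + \<theta> * v + 1 / (1 - \<theta>)" if \<theta>: "0 < \<theta>" "\<theta> < 1" for \<theta>
  proof -
    let ?T = "\<lambda>x. x(i := (1 - \<theta>) * x i + \<theta> * m i)"
    define D where "D x = \<theta> * (C\<psi> * \<bar>x i - m i\<bar> - a * (x i - m i) + \<theta> * M i i * (x i - m i)\<^sup>2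
       - 2 * (\<Sum>j\<in>\<Lambda>. M i j * ((x i - m i) * x j)))" for x
    have sD: "subexponential \<Lambda> (\<lambda>x. 1 - D x)"
      unfolding D_def power2_eq_square
      by (intro subexponential_intros sub assms)
    have fm: "(\<lambda>x. ennreal (exp (- H \<Lambda> \<omega> x))) \<in> borel_measurable (P \<Lambda>)"
      using H_measurable by measurable
    have T: "?T \<in> measurable (P \<Lambda>) (P \<Lambda>)"
      by (intro measurable_fun_upd[where J = \<Lambda>]) (use assms coordinate_measurable[of i \<Lambda>] in auto)
    have Tm: "(\<lambda>x. exp (- H \<Lambda> \<omega> (?T x))) \<in> borel_measurable (P \<Lambda>)"
      using measurable_compose[OF T H_measurable] by measurable
    have "ennreal (Z \<Lambda> \<omega>) = (\<integral>\<^sup>+x. ennreal (exp (- H \<Lambda> \<omega> x)) \<partial>P \<Lambda>)"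
      unfolding partition_function_def
      by (intro nn_integral_eq_integral[symmetric] integrable_exp_H assms) auto
    also have "\<dots> = ennreal (1 - \<theta>) * (\<integral>\<^sup>+x. ennreal (exp (- H \<Lambda> \<omega> (?T x))) \<partial>P \<Lambda>)"
      by (rule nn_integral_contract_coordinate[OF assms(1,2) \<theta>(2) fm])
    finally have eq: "ennreal (Z \<Lambda> \<omega>) = ennreal (1 - \<theta>) * (\<integral>\<^sup>+x. ennreal (exp (- H \<Lambda> \<omega> (?T x))) \<partial>P \<Lambda>)" .
    \<comment> \<open>Finiteness of \<open>Z\<close>, carried over by the change of variable, makes
      the contracted weight integrable.\<close>
    then have "(\<integral>\<^sup>+x. ennreal (exp (- H \<Lambda> \<omega> (?T x))) \<partial>P \<Lambda>) < \<infinity>"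
      using \<theta> by (auto simp: less_top[symmetric] ennreal_mult_top)
    then have iT: "integrable (P \<Lambda>) (\<lambda>x. exp (- H \<Lambda> \<omega> (?T x)))"
      using Tm by (intro integrableI_nonneg) auto
    have "ennreal (Z \<Lambda> \<omega>) = ennreal ((1 - \<theta>) * (\<integral>x. exp (- H \<Lambda> \<omega> (?T x)) \<partial>P \<Lambda>))"
      unfolding eq using \<theta> nn_integral_eq_integral[OF iT] by (simp add: ennreal_mult')
    then have ZT: "Z \<Lambda> \<omega> = (1 - \<theta>) * (\<integral>x. exp (- H \<Lambda> \<omega> (?T x)) \<partial>P \<Lambda>)"
      using \<theta> Z_pos[OF assms(1), of \<omega>] by (subst (asm) ennreal_inj) auto
    have "(\<integral>x. exp (- H \<Lambda> \<omega> x) * (1 - D x) \<partial>P \<Lambda>) \<le> (\<integral>x. exp (- H \<Lambda> \<omega> (?T x)) \<partial>P \<Lambda>)"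
    proof (rule integral_mono[OF integrable_exp_H_mult[OF assms(1) sD] iT])
      fix x
      have "H \<Lambda> \<omega> (?T x) \<le> H \<Lambda> \<omega> x + D x"
        using H_contract_coordinate[OF assms(1,2), of \<theta> \<omega> x "m i"] \<theta> by (simp add: D_def a_def)
      then have "exp (- H \<Lambda> \<omega> x) * exp (- D x) \<le> exp (- H \<Lambda> \<omega> (?T x))" by (simp flip: exp_add)
      \<comment> \<open>\<open>exp (- D) \<ge> 1 - D\<close> makes the comparison linear in
        \<open>D\<close>, whose expectation can be computed term by term.\<close>
      moreover have "exp (- H \<Lambda> \<omega> x) * (1 - D x) \<le> exp (- H \<Lambda> \<omega> x) * exp (- D x)"
        using exp_ge_add_one_self[of "- D x"] by (intro mult_left_mono) auto
      ultimately show "exp (- H \<Lambda> \<omega> x) * (1 - D x) \<le> exp (- H \<Lambda> \<omega> (?T x))" by linarith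
    qed
    moreover have "(\<integral>x. exp (- H \<Lambda> \<omega> x) * (1 - D x) \<partial>P \<Lambda>) = Z \<Lambda> \<omega> * ?E (\<lambda>x. 1 - D x)"
      using integral_gibbs[OF assms(1) subexponential_measurable[OF sD], of \<omega>] Z_pos[OF assms(1), of \<omega>]
      by simp
    ultimately have "(1 - \<theta>) * (Z \<Lambda> \<omega> * ?E (\<lambda>x. 1 - D x)) \<le> Z \<Lambda> \<omega> * 1"
      using ZT mult_left_mono[of _ _ "1 - \<theta>"] \<theta> by simp
    then have "(1 - \<theta>) * ?E (\<lambda>x. 1 - D x) \<le> 1"
      using Z_pos[OF assms(1), of \<omega>] by (simp add: mult.left_commute)
    moreover have "?E (\<lambda>x. 1 - D x) = 1 - \<theta> * (b + \<theta> * v - 2 * c)"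
    proof -
      have "?E D = \<theta> * (C\<psi> * ?E (\<lambda>x. \<bar>x i - m i\<bar>) - a * ?E (\<lambda>x. x i - m i) + \<theta> * M i i * ?E (\<lambda>x. (x i - m i)\<^sup>2)
         - 2 * (\<Sum>j\<in>\<Lambda>. M i j * ?E (\<lambda>x. (x i - m i) * x j)))"
        unfolding D_def using iu ij by simp
      also have "\<dots> = \<theta> * (b + \<theta> * v - 2 * c)"
        using Eu Euj by (simp add: b_def c_def v_def)
      finally have "?E D = \<theta> * (b + \<theta> * v - 2 * c)" .
      moreover have "integrable (\<mu> \<Lambda> \<omega>) D"
        using int[OF subexponential_diff[OF subexponential_const[of _ 1] sD]] by simp
      ultimately show ?thesis by (simp add: prob_space)
    qed
    ultimately have "1 - \<theta> * (b + \<theta> * v - 2 * c) \<le> 1 / (1 - \<theta>)"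
      using \<theta> by (simp add: field_simps)
    \<comment> \<open>With this form of the right-hand side the constants 1 cancel, and what remains
      is divisible by \<theta>.\<close>
    also have "1 / (1 - \<theta>) = 1 + \<theta> * (1 / (1 - \<theta>))" using \<theta> by (simp add: field_simps)
    finally have "\<theta> * (2 * c) \<le> \<theta> * (b + \<theta> * v + 1 / (1 - \<theta>))" by (simp add: algebra_simps)
    then show ?thesis using \<theta>(1) by simp
  qed
  have "((\<lambda>\<theta>. b + \<theta> * v + 1 / (1 - \<theta>)) \<longlongrightarrow> b + 0 * v + 1 / (1 - 0)) (at_right 0)"
    by (intro tendsto_intros) auto
  moreover have "\<forall>\<^sub>F \<theta> in at_right 0. 2 * c \<le> b + \<theta> * v + 1 / (1 - \<theta>)"
    by (rule eventually_mono[OF eventually_at_right_real[of 0 1]]) (use main in auto)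
  ultimately have "2 * c \<le> b + 0 * v + 1 / (1 - 0)"
    by (intro tendsto_lowerbound) auto
  then show ?thesis by (simp add: b_def c_def)
qed

text \<open>Solves \<open>\<delta> * V \<le> 1 + C\<psi>\<^sup>2 / (4 * \<delta>)\<close> for
  \<open>V\<close>. Neither the volume nor the boundary condition enters.\<close>

definition variance_bound :: real where
  "variance_bound = (1 + C\<psi>\<^sup>2 / (4 * \<delta>)) / \<delta>"

lemma variance_bound_pos: "variance_bound > 0"
  using \<delta>_pos by (simp add: variance_bound_def add_pos_nonneg)

text \<open>At a site of maximal variance \<open>V\<close> every covariance with another spin is at
  most \<open>V\<close> in absolute value. Diagonal dominance therefore bounds the left side of
  \<open>covariance_inequality\<close> below by \<open>2 * \<delta> * V\<close>.\<close>

theorem variance_le: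
  fixes \<omega> :: "'d config"
  assumes "finite \<Lambda>" "k \<in> \<Lambda>"
  defines "m \<equiv> \<lambda>k. \<integral>x. x k \<partial>\<mu> \<Lambda> \<omega>"
  shows "(\<integral>x. (x k - m k)\<^sup>2 \<partial>\<mu> \<Lambda> \<omega>) \<le> variance_bound"
proof -
  let ?E = "\<lambda>k :: 'd config \<Rightarrow> real. \<integral>x. k x \<partial>\<mu> \<Lambda> \<omega>"
  let ?V = "\<lambda>j. ?E (\<lambda>x. (x j - m j)\<^sup>2)"
  interpret prob_space "\<mu> \<Lambda> \<omega>" by (rule prob_space_gibbs[OF assms(1)])
  note int = integrable_gibbs[OF assms(1), where \<omega> = \<omega>]
  have sub: "subexponential \<Lambda> (\<lambda>x. x j - m j)" if "j \<in> \<Lambda>" for j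
    by (intro subexponential_intros that assms(1))
  have iV: "integrable (\<mu> \<Lambda> \<omega>) (\<lambda>x. (x j - m j)\<^sup>2)" if "j \<in> \<Lambda>" for j
    unfolding power2_eq_square using sub[OF that] by (auto intro!: int subexponential_intros)
  have ia: "integrable (\<mu> \<Lambda> \<omega>) (\<lambda>x. \<bar>x j - m j\<bar>)" if "j \<in> \<Lambda>" for j
    using sub[OF that] by (auto intro!: int subexponential_intros)
  have iC: "integrable (\<mu> \<Lambda> \<omega>) (\<lambda>x. (x i - m i) * (x j - m j))" if "i \<in> \<Lambda>" "j \<in> \<Lambda>" for i j
    using sub[OF that(1)] sub[OF that(2)] by (auto intro!: int subexponential_intros)
  have "Max (?V ` \<Lambda>) \<in> ?V ` \<Lambda>" using assms by (intro Max_in) auto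
  then obtain i where i: "i \<in> \<Lambda>" "?V i = Max (?V ` \<Lambda>)" by auto
  have max: "?V j \<le> ?V i" if "j \<in> \<Lambda>" for j
    unfolding i(2) using assms(1) that by (intro Max_ge) auto
  have "- \<bar>M i j\<bar> * ?V i \<le> M i j * ?E (\<lambda>x. (x i - m i) * (x j - m j))" if "j \<in> \<Lambda>" for j
  proof -
    have "\<bar>?E (\<lambda>x. (x i - m i) * (x j - m j))\<bar> \<le> ?E (\<lambda>x. \<bar>(x i - m i) * (x j - m j)\<bar>)"
      by (rule integral_abs_bound)
    also have "\<dots> \<le> ?E (\<lambda>x. ((x i - m i)\<^sup>2 + (x j - m j)\<^sup>2) / 2)"
      using iC[OF i(1) that] iV[OF i(1)] iV[OF that]
      by (intro integral_mono abs_mult_le_half_sum_squares integrable_abs) auto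
    also have "\<dots> = (?V i + ?V j) / 2" using iV[OF i(1)] iV[OF that] by simp
    also have "\<dots> \<le> ?V i" using max[OF that] by simp
    finally have "\<bar>M i j * ?E (\<lambda>x. (x i - m i) * (x j - m j))\<bar> \<le> \<bar>M i j\<bar> * ?V i"
      unfolding abs_mult by (intro mult_left_mono) auto
    then show ?thesis by linarith
  qed
  then have "(\<Sum>j\<in>\<Lambda> - {i}. - \<bar>M i j\<bar> * ?V i) \<le> (\<Sum>j\<in>\<Lambda> - {i}. M i j * ?E (\<lambda>x. (x i - m i) * (x j - m j)))"
    by (intro sum_mono) auto
  moreover have "(\<Sum>j\<in>\<Lambda> - {i}. - \<bar>M i j\<bar> * ?V i) = - (\<Sum>j\<in>\<Lambda> - {i}. \<bar>M i j\<bar>) * ?V i"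
    by (simp add: sum_distrib_right sum_negf)
  moreover have "(\<Sum>j\<in>\<Lambda> - {i}. \<bar>M i j\<bar>) * ?V i \<le> (M i i - \<delta>) * ?V i"
    by (intro mult_right_mono row_sum_le assms(1)) auto
  moreover have "(\<Sum>j\<in>\<Lambda>. M i j * ?E (\<lambda>x. (x i - m i) * (x j - m j)))
     = M i i * ?V i + (\<Sum>j\<in>\<Lambda> - {i}. M i j * ?E (\<lambda>x. (x i - m i) * (x j - m j)))"
    using assms(1) i(1) by (simp add: sum.remove[of \<Lambda> i] power2_eq_square)
  ultimately have "\<delta> * ?V i \<le> (\<Sum>j\<in>\<Lambda>. M i j * ?E (\<lambda>x. (x i - m i) * (x j - m j)))"
    by (simp add: algebra_simps)
  then have 1: "2 * (\<delta> * ?V i) \<le> 1 + C\<psi> * ?E (\<lambda>x. \<bar>x i - m i\<bar>)"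
    using covariance_inequality[OF assms(1) i(1), of \<omega>] unfolding m_def by linarith
  \<comment> \<open>Young's inequality with weight \<delta>: half of
    \<open>2 * (\<delta> * ?V i)\<close> absorbs the quadratic term.\<close>
  have "C\<psi> * ?E (\<lambda>x. \<bar>x i - m i\<bar>) = ?E (\<lambda>x. C\<psi> * \<bar>x i - m i\<bar>)" by simp
  also have "\<dots> \<le> ?E (\<lambda>x. \<delta> * (x i - m i)\<^sup>2 + C\<psi>\<^sup>2 / (4 * \<delta>))"
  proof (intro integral_mono)
    fix x
    have "0 \<le> (2 * \<delta> * \<bar>x i - m i\<bar> - C\<psi>)\<^sup>2 / (4 * \<delta>)" using \<delta>_pos by simp
    also have "\<dots> = \<delta> * \<bar>x i - m i\<bar>\<^sup>2 + C\<psi>\<^sup>2 / (4 * \<delta>) - C\<psi> * \<bar>x i - m i\<bar>"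
      using \<delta>_pos by (simp add: power2_diff power_mult_distrib field_simps power2_eq_square)
    finally show "C\<psi> * \<bar>x i - m i\<bar> \<le> \<delta> * (x i - m i)\<^sup>2 + C\<psi>\<^sup>2 / (4 * \<delta>)" by simp
  qed (use ia[OF i(1)] iV[OF i(1)] in auto)
  also have "\<dots> = \<delta> * ?V i + C\<psi>\<^sup>2 / (4 * \<delta>)" using iV[OF i(1)] by (simp add: prob_space)
  finally have "\<delta> * ?V i \<le> 1 + C\<psi>\<^sup>2 / (4 * \<delta>)" using 1 by linarith
  then have "?V i \<le> variance_bound" using \<delta>_pos by (simp add: variance_bound_def field_simps)
  then show ?thesis using max[OF assms(2)] by linarith
qed

end

subsection \<open>Covariances of Lipschitz functions\<close>

text \<open>The centring constants are free. \<open>cov_le\<close> takes the values of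
  \<open>f\<close> and \<open>g\<close> at the configuration of mean spins, where the Lipschitz
  bounds apply.\<close>

lemma (in prob_space) cov_shift:
  assumes "integrable M f" "integrable M g" "integrable M (\<lambda>x. f x * g x)"
  shows "cov M f g = expectation (\<lambda>x. (f x - a) * (g x - b)) - (expectation f - a) * (expectation g - b)"
proof -
  have "cov M f g = expectation (\<lambda>x. f x * g x - expectation g * f x - expectation f * g x + expectation f * expectation g)"
    unfolding cov_def by (intro Bochner_Integration.integral_cong) (auto simp: algebra_simps)
  also have "\<dots> = expectation (\<lambda>x. f x * g x) - expectation f * expectation g"
    using assms by (simp add: prob_space)
  finally have "cov M f g = expectation (\<lambda>x. f x * g x) - expectation f * expectation g" .
  moreover have "expectation (\<lambda>x. (f x - a) * (g x - b)) = expectation (\<lambda>x. f x * g x - b * f x - a * g x + a * b)"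
    by (intro Bochner_Integration.integral_cong) (auto simp: algebra_simps)
  moreover have "\<dots> = expectation (\<lambda>x. f x * g x) - b * expectation f - a * expectation g + a * b"
    using assms by (simp add: prob_space)
  ultimately show ?thesis by (simp add: algebra_simps)
qed

lemma (in prob_space) cov_eq:
  assumes "integrable M f" "integrable M g" "integrable M (\<lambda>x. f x * g x)"
  shows "cov M f g = expectation (\<lambda>x. f x * g x) - expectation f * expectation g"
  using cov_shift[OF assms, of 0 0] by simp

context spin_system begin

text \<open>Both the mixed moment of \<open>f - f m\<close> and \<open>g - g m\<close> and the
  product of their means are at most \<open>variance_bound * (K * card F) * (L * card G)\<close> in
  absolute value; adding the two explains the factor 2.\<close>

lemma cov_le:
  fixes \<omega> :: "'d config"
  assumes "finite \<Lambda>" "F \<subseteq> \<Lambda>" "G \<subseteq> \<Lambda>" "K \<ge> 0" "L \<ge> 0"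
    and f: "f \<in> borel_measurable (P \<Lambda>)" "\<And>x y. \<bar>f x - f y\<bar> \<le> K * (\<Sum>k\<in>F. \<bar>x k - y k\<bar>)"
    and g: "g \<in> borel_measurable (P \<Lambda>)" "\<And>x y. \<bar>g x - g y\<bar> \<le> L * (\<Sum>k\<in>G. \<bar>x k - y k\<bar>)"
  shows "\<bar>cov (\<mu> \<Lambda> \<omega>) f g\<bar> \<le> 2 * variance_bound * (K * real (card F)) * (L * real (card G))"
proof -
  let ?E = "\<lambda>k :: 'd config \<Rightarrow> real. \<integral>x. k x \<partial>\<mu> \<Lambda> \<omega>"
  define m where "m k = ?E (\<lambda>x. x k)" for k
  define S where "S I x = (\<Sum>k\<in>I. \<bar>x k - m k\<bar>)" for I and x :: "'d config"
  let ?A = variance_bound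
  interpret prob_space "\<mu> \<Lambda> \<omega>" by (rule prob_space_gibbs[OF assms(1)])
  note int = integrable_gibbs[OF assms(1), where \<omega> = \<omega>]
  have subf: "subexponential \<Lambda> f" and subg: "subexponential \<Lambda> g"
    using subexponential_Lipschitz[OF assms(1,2) f(1), of m K] f(2)
      subexponential_Lipschitz[OF assms(1,3) g(1), of m L] g(2) by auto
  have sub: "subexponential \<Lambda> (\<lambda>x. \<bar>x k - m k\<bar>)" if "k \<in> \<Lambda>" for k
    by (intro subexponential_intros that assms(1))
  have subS: "subexponential \<Lambda> (S I)" if "I \<subseteq> \<Lambda>" for I
    unfolding S_def[abs_def] using that sub by (intro subexponential_sum) auto
  have iV: "integrable (\<mu> \<Lambda> \<omega>) (\<lambda>x. (x k - m k)\<^sup>2)" if "k \<in> \<Lambda>" for k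
    unfolding power2_eq_square by (intro int subexponential_intros that assms(1))
  have V: "?E (\<lambda>x. (x k - m k)\<^sup>2) \<le> ?A" if "k \<in> \<Lambda>" for k
    using variance_le[OF assms(1) that] by (simp add: m_def)
  have E2: "?E (\<lambda>x. \<bar>x k - m k\<bar> * \<bar>x l - m l\<bar>) \<le> ?A" if "k \<in> \<Lambda>" "l \<in> \<Lambda>" for k l
  proof -
    have "?E (\<lambda>x. \<bar>x k - m k\<bar> * \<bar>x l - m l\<bar>) \<le> ?E (\<lambda>x. ((x k - m k)\<^sup>2 + (x l - m l)\<^sup>2) / 2)"
    proof (rule integral_mono)
      show "integrable (\<mu> \<Lambda> \<omega>) (\<lambda>x. \<bar>x k - m k\<bar> * \<bar>x l - m l\<bar>)"
        by (intro int subexponential_mult sub that)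
      show "\<bar>x k - m k\<bar> * \<bar>x l - m l\<bar> \<le> ((x k - m k)\<^sup>2 + (x l - m l)\<^sup>2) / 2" for x
        unfolding abs_mult[symmetric] by (rule abs_mult_le_half_sum_squares)
    qed (use iV that in auto)
    also have "\<dots> = (?E (\<lambda>x. (x k - m k)\<^sup>2) + ?E (\<lambda>x. (x l - m l)\<^sup>2)) / 2"
      using iV that by simp
    also have "\<dots> \<le> ?A" using V[OF that(1)] V[OF that(2)] by simp
    finally show ?thesis .
  qed
  \<comment> \<open>The first absolute moment is controlled by the second, as the variance of
    \<open>\<bar>x k - m k\<bar>\<close> is nonnegative.\<close>
  have E1: "?E (\<lambda>x. \<bar>x k - m k\<bar>) \<le> sqrt ?A" if "k \<in> \<Lambda>" for k
  proof -
    have "0 \<le> variance (\<lambda>x. \<bar>x k - m k\<bar>)" by (rule variance_positive)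
    also have "\<dots> = ?E (\<lambda>x. (x k - m k)\<^sup>2) - (?E (\<lambda>x. \<bar>x k - m k\<bar>))\<^sup>2"
      using int[OF sub[OF that]] iV[OF that] by (subst variance_eq) auto
    finally show ?thesis using V[OF that] by (intro real_le_rsqrt) linarith
  qed
  have ES: "?E (S I) \<le> real (card I) * sqrt ?A" if "I \<subseteq> \<Lambda>" for I
  proof -
    have "?E (S I) = (\<Sum>k\<in>I. ?E (\<lambda>x. \<bar>x k - m k\<bar>))"
      unfolding S_def using that int[OF sub] by (intro Bochner_Integration.integral_sum) auto
    also have "\<dots> \<le> real (card I) * sqrt ?A" using that E1 by (intro sum_bounded_above) auto
    finally show ?thesis .
  qed
  have ES0: "?E (S I) \<ge> 0" for I unfolding S_def by (simp add: sum_nonneg)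
  have ESS: "?E (\<lambda>x. S F x * S G x) \<le> real (card F) * (real (card G) * ?A)"
  proof -
    have "?E (\<lambda>x. S F x * S G x) = (\<Sum>k\<in>F. \<Sum>l\<in>G. ?E (\<lambda>x. \<bar>x k - m k\<bar> * \<bar>x l - m l\<bar>))"
      unfolding S_def sum_product using assms(2,3) int[OF subexponential_mult[OF sub sub]]
      by (subst Bochner_Integration.integral_sum; intro Bochner_Integration.integrable_sum sum.cong refl
          Bochner_Integration.integral_sum) auto
    also have "\<dots> \<le> real (card F) * (real (card G) * ?A)"
      using E2 assms(2,3) by (intro sum_bounded_above) auto
    finally show ?thesis .
  qed
  have fS: "\<bar>f x - f m\<bar> \<le> K * S F x" and gS: "\<bar>g x - g m\<bar> \<le> L * S G x" for x
    unfolding S_def by (rule f(2), rule g(2))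
  have c: "cov (\<mu> \<Lambda> \<omega>) f g = ?E (\<lambda>x. (f x - f m) * (g x - g m)) - (?E f - f m) * (?E g - g m)"
    by (intro cov_shift int subf subg subexponential_mult)
  have "\<bar>?E (\<lambda>x. (f x - f m) * (g x - g m))\<bar> \<le> ?E (\<lambda>x. \<bar>(f x - f m) * (g x - g m)\<bar>)"
    by (rule integral_abs_bound)
  also have "\<dots> \<le> ?E (\<lambda>x. K * L * (S F x * S G x))"
  proof (rule integral_mono)
    fix x
    have "\<bar>(f x - f m) * (g x - g m)\<bar> \<le> (K * S F x) * (L * S G x)"
      unfolding abs_mult using fS gS by (intro mult_mono) (auto intro: order_trans[OF abs_ge_zero])
    then show "\<bar>(f x - f m) * (g x - g m)\<bar> \<le> K * L * (S F x * S G x)" by (simp add: mult_ac)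
  qed (intro int subexponential_intros subf subg subS assms)+
  also have "\<dots> = K * L * ?E (\<lambda>x. S F x * S G x)" by simp
  also have "\<dots> \<le> K * L * (real (card F) * (real (card G) * ?A))"
    using ESS assms(4,5) by (intro mult_left_mono) auto
  finally have 1: "\<bar>?E (\<lambda>x. (f x - f m) * (g x - g m))\<bar> \<le> ?A * (K * real (card F)) * (L * real (card G))"
    by (simp add: mult_ac)
  have mean: "\<bar>?E k - k m\<bar> \<le> R * (real (card I) * sqrt ?A)"
    if "subexponential \<Lambda> k" "\<And>x. \<bar>k x - k m\<bar> \<le> R * S I x" "R \<ge> 0" "I \<subseteq> \<Lambda>" for k R I
  proof -
    have "?E k - k m = ?E (\<lambda>x. k x - k m)" using int[OF that(1)] by (simp add: prob_space)
    then have "\<bar>?E k - k m\<bar> \<le> ?E (\<lambda>x. \<bar>k x - k m\<bar>)" by (simp only: integral_abs_bound)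
    also have "\<dots> \<le> ?E (\<lambda>x. R * S I x)"
      by (intro integral_mono int subexponential_intros subS that)
    also have "\<dots> = R * ?E (S I)" by simp
    also have "\<dots> \<le> R * (real (card I) * sqrt ?A)" using ES that by (intro mult_left_mono) auto
    finally show ?thesis .
  qed
  have "\<bar>(?E f - f m) * (?E g - g m)\<bar> \<le> (K * (real (card F) * sqrt ?A)) * (L * (real (card G) * sqrt ?A))"
    unfolding abs_mult using mean[OF subf fS assms(4,2)] mean[OF subg gS assms(5,3)]
    by (intro mult_mono) (auto intro: order_trans[OF abs_ge_zero])
  also have "\<dots> = (sqrt ?A * sqrt ?A) * (K * real (card F)) * (L * real (card G))"
    by (simp only: mult_ac)
  also have "sqrt ?A * sqrt ?A = ?A" using variance_bound_pos by simp
  finally have 2: "\<bar>(?E f - f m) * (?E g - g m)\<bar> \<le> ?A * (K * real (card F)) * (L * real (card G))" .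
  have "\<bar>cov (\<mu> \<Lambda> \<omega>) f g\<bar> \<le> ?A * (K * real (card F)) * (L * real (card G)) + ?A * (K * real (card F)) * (L * real (card G))"
    unfolding c using 1 2 abs_triangle_ineq4 by (smt (verit))
  then show ?thesis by (simp add: mult_ac)
qed

end

subsection \<open>Conditioning on part of the spins\<close>

text \<open>Serves as a boundary condition for \<open>\<Lambda> - G\<close> in which the spins of
  \<open>x\<close> in \<open>G\<close> are frozen.\<close>

definition override :: "'d site set \<Rightarrow> 'd config \<Rightarrow> 'd config \<Rightarrow> 'd config" where
  "override G x \<omega> = (\<lambda>k. if k \<in> G then x k else \<omega> k)"

lemma summable_on_finite_modification:
  fixes f g :: "'a \<Rightarrow> real"
  assumes "f summable_on A" "finite B" "\<And>j. j \<in> A - B \<Longrightarrow> g j = f j" "A' \<subseteq> A \<union> B"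
  shows "g summable_on A'"
proof -
  have "f summable_on A - B"
    by (metis Diff_subset assms(1) summable_on_subset_banach)
  then have "g summable_on A - B"
    using summable_on_cong[of "A - B" g f] assms(3) by auto
  then have "g summable_on (A - B) \<union> B"
    by (rule summable_on_union[OF _ summable_on_finite[OF assms(2)]])
  then show ?thesis by (rule summable_on_subset_banach) (use assms(4) in auto)
qed

text \<open>Covers both the freezing of spins inside \<Lambda>, with \<open>B = G\<close>, and the
  change of one boundary spin, with \<open>B = {i}\<close>.\<close>

lemma tempered_modify:
  assumes "tempered M \<Lambda> \<omega>" "\<Lambda>' \<subseteq> \<Lambda>" "finite B" "\<And>j. j \<notin> \<Lambda> \<Longrightarrow> j \<notin> B \<Longrightarrow> \<omega>' j = \<omega> j" "\<Lambda> - \<Lambda>' \<subseteq> B"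
  shows "tempered M \<Lambda>' \<omega>'"
  unfolding tempered_def
proof
  fix i assume "i \<in> \<Lambda>'"
  then have "(\<lambda>j. \<bar>M i j\<bar> * \<bar>\<omega> j\<bar>) summable_on - \<Lambda>"
    using assms(1,2) unfolding tempered_def by blast
  then show "(\<lambda>j. \<bar>M i j\<bar> * \<bar>\<omega>' j\<bar>) summable_on - \<Lambda>'"
    by (rule summable_on_finite_modification[where B = B]) (use assms in auto)
qed

lemma tempered_summable:
  assumes "tempered M \<Lambda> \<omega>" "i \<in> \<Lambda>"
  shows "(\<lambda>j. M i j * \<omega> j) summable_on - \<Lambda>"
proof -
  have "(\<lambda>j. \<bar>M i j * \<omega> j\<bar>) summable_on - \<Lambda>"
    using assms by (simp add: tempered_def abs_mult)
  then show ?thesis by (subst summable_on_iff_abs_summable_on_real) simp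
qed

text \<open>The complement of the smaller volume is that of \<Lambda> enlarged by the finite set
  \<open>G\<close>, and temperedness allows the infinite sum to be split accordingly.\<close>

lemma boundary_field_override:
  assumes "tempered M \<Lambda> \<omega>" "finite \<Lambda>" "G \<subseteq> \<Lambda>" "i \<in> \<Lambda>"
  shows "boundary_field M (\<Lambda> - G) (override G x \<omega>) i = boundary_field M \<Lambda> \<omega> i + (\<Sum>k\<in>G. M i k * x k)"
proof -
  have G: "finite G" using assms finite_subset by blast
  have eq: "- (\<Lambda> - G) = - \<Lambda> \<union> G" using assms by auto
  have sm: "(\<lambda>j. M i j * override G x \<omega> j) summable_on - \<Lambda>"
    using tempered_summable[OF assms(1,4)] assms(3)
    by (subst summable_on_cong[where g = "\<lambda>j. M i j * \<omega> j"]) (auto simp: override_def)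
  have "boundary_field M (\<Lambda> - G) (override G x \<omega>) i
     = (\<Sum>\<^sub>\<infinity>j\<in>-\<Lambda>. M i j * override G x \<omega> j) + (\<Sum>\<^sub>\<infinity>j\<in>G. M i j * override G x \<omega> j)"
    unfolding boundary_field_def eq using sm G assms(3)
    by (intro infsum_Un_disjoint) auto
  also have "(\<Sum>\<^sub>\<infinity>j\<in>-\<Lambda>. M i j * override G x \<omega> j) = boundary_field M \<Lambda> \<omega> i"
    unfolding boundary_field_def using assms(3) by (intro infsum_cong) (auto simp: override_def)
  also have "(\<Sum>\<^sub>\<infinity>j\<in>G. M i j * override G x \<omega> j) = (\<Sum>k\<in>G. M i k * x k)"
    using G by (simp add: override_def)
  finally show ?thesis .
qed

lemma hamiltonian_cong:
  assumes "\<And>k. k \<in> \<Lambda> \<Longrightarrow> x k = y k" "\<And>k. k \<notin> \<Lambda> \<Longrightarrow> \<omega> k = \<omega>' k"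
  shows "hamiltonian \<psi> s M \<Lambda> \<omega> x = hamiltonian \<psi> s M \<Lambda> \<omega>' y"
proof -
  have "boundary_field M \<Lambda> \<omega> i = boundary_field M \<Lambda> \<omega>' i" for i
    unfolding boundary_field_def using assms(2) by (intro infsum_cong) auto
  then show ?thesis using assms(1) by (simp add: hamiltonian_eq)
qed

lemma gibbs_cong:
  assumes "\<And>k. k \<notin> \<Lambda> \<Longrightarrow> \<omega> k = \<omega>' k"
  shows "gibbs \<psi> s M \<Lambda> \<omega> = gibbs \<psi> s M \<Lambda> \<omega>'"
proof -
  have "hamiltonian \<psi> s M \<Lambda> \<omega> x = hamiltonian \<psi> s M \<Lambda> \<omega>' x" for x
    by (rule hamiltonian_cong) (use assms in auto)
  then show ?thesis by (simp add: gibbs_def partition_function_def)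
qed

section \<open>Conditional expectations and their dependence on frozen spins\<close>

context spin_system begin

text \<open>In the symmetric double sum each pair between \<open>G\<close> and
  \<open>\<Lambda> - G\<close> occurs twice, which matches the factor 2 of the boundary field. Hence
  freezing \<open>G\<close> leads to a Gibbs measure again.\<close>

lemma H_split:
  assumes "tempered M \<Lambda> \<omega>" "finite \<Lambda>" "G \<subseteq> \<Lambda>"
  shows "H \<Lambda> \<omega> x = ((\<Sum>i\<in>G. \<psi> i (x i) + (s i + 2 * boundary_field M \<Lambda> \<omega> i) * x i)
     + (\<Sum>i\<in>G. \<Sum>j\<in>G. M i j * x i * x j)) + H (\<Lambda> - G) (override G x \<omega>) x"
proof -
  let ?L = "\<Lambda> - G"
  let ?q = "\<lambda>i j. M i j * x i * x j"
  have G: "finite G" using assms finite_subset by blast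
  have un: "sum f \<Lambda> = sum f G + sum f ?L" for f :: "'d site \<Rightarrow> real"
    using assms G by (metis sum.subset_diff add.commute)
  have "(\<Sum>i\<in>G. \<Sum>j\<in>?L. ?q i j) = (\<Sum>i\<in>?L. \<Sum>j\<in>G. ?q i j)"
    by (subst sum.swap) (intro sum.cong refl, auto simp: M_sym)
  then have "(\<Sum>i\<in>\<Lambda>. \<Sum>j\<in>\<Lambda>. ?q i j)
     = (\<Sum>i\<in>G. \<Sum>j\<in>G. ?q i j) + 2 * (\<Sum>i\<in>?L. \<Sum>j\<in>G. ?q i j) + (\<Sum>i\<in>?L. \<Sum>j\<in>?L. ?q i j)"
    by (simp add: un sum.distrib)
  moreover have "(\<Sum>i\<in>?L. \<psi> i (x i) + (s i + 2 * boundary_field M ?L (override G x \<omega>) i) * x i)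
     = (\<Sum>i\<in>?L. \<psi> i (x i) + (s i + 2 * boundary_field M \<Lambda> \<omega> i) * x i) + 2 * (\<Sum>i\<in>?L. \<Sum>j\<in>G. ?q i j)"
    unfolding sum_distrib_left sum.distrib[symmetric]
    by (intro sum.cong refl)
       (use assms in \<open>simp add: boundary_field_override ring_distribs sum_distrib_left mult_ac\<close>)
  ultimately show ?thesis
    unfolding hamiltonian_eq by (simp add: un)
qed

text \<open>A version of the conditional expectation given the spins in \<open>G\<close>, for
  \<open>f\<close> that depends on the other spins of \<Lambda>. It is defined at every
  configuration, so that pointwise Lipschitz bounds make sense.\<close>

definition conditional :: "'d site set \<Rightarrow> 'd config \<Rightarrow> 'd site set \<Rightarrow> ('d config \<Rightarrow> real) \<Rightarrow> 'd config \<Rightarrow> real" where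
  "conditional \<Lambda> \<omega> G f x = (\<integral>y. f y \<partial>\<mu> (\<Lambda> - G) (override G x \<omega>))"

lemma conditional_depends_only_on: "depends_only_on (conditional \<Lambda> \<omega> G f) G"
  unfolding depends_only_on_def
proof (intro allI impI)
  fix x y :: "'d config" assume "\<forall>i\<in>G. x i = y i"
  then have "override G x \<omega> = override G y \<omega>" by (auto simp: override_def)
  then show "conditional \<Lambda> \<omega> G f x = conditional \<Lambda> \<omega> G f y" by (simp add: conditional_def)
qed

text \<open>Tower property: in the iterated integral the inner one, over
  \<open>\<Lambda> - G\<close>, is the partition function of that volume times the conditional
  expectation.\<close>

lemma expectation_conditional:
  assumes "tempered M \<Lambda> \<omega>" "finite \<Lambda>" "G \<subseteq> \<Lambda>"
    and f: "depends_only_on f (\<Lambda> - G)" "f \<in> borel_measurable (P (\<Lambda> - G))"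
    and g: "depends_only_on g G"
    and fg: "subexponential \<Lambda> (\<lambda>x. f x * g x)" "subexponential \<Lambda> (\<lambda>x. conditional \<Lambda> \<omega> G f x * g x)"
  shows "(\<integral>x. f x * g x \<partial>\<mu> \<Lambda> \<omega>) = (\<integral>x. conditional \<Lambda> \<omega> G f x * g x \<partial>\<mu> \<Lambda> \<omega>)"
proof -
  let ?L = "\<Lambda> - G" and ?f = "conditional \<Lambda> \<omega> G f"
  interpret product_sigma_finite "\<lambda>_. lborel :: real measure" by (rule product_sigma_finite_lborel)
  have fin: "finite G" "finite ?L" "G \<inter> ?L = {}" "G \<union> ?L = \<Lambda>" using assms finite_subset by auto
  \<comment> \<open>The part of the energy that is constant for the inner integral.\<close>
  define h where "h x = (\<Sum>i\<in>G. \<psi> i (x i) + (s i + 2 * boundary_field M \<Lambda> \<omega> i) * x i)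
     + (\<Sum>i\<in>G. \<Sum>j\<in>G. M i j * x i * x j)" for x
  have Hm: "H \<Lambda> \<omega> (merge G ?L (x, y)) = h x + H ?L (override G x \<omega>) y" for x y
  proof -
    have "h (merge G ?L (x, y)) = h x" unfolding h_def by (simp add: merge_def)
    moreover have "H ?L (override G (merge G ?L (x, y)) \<omega>) (merge G ?L (x, y)) = H ?L (override G x \<omega>) y"
      by (rule hamiltonian_cong) (auto simp: merge_def override_def)
    ultimately show ?thesis using H_split[OF assms(1-3), of "merge G ?L (x, y)"] by (simp add: h_def)
  qed
  have gm: "g (merge G ?L (x, y)) = g x" "?f (merge G ?L (x, y)) = ?f x" "f (merge G ?L (x, y)) = f y" for x y
    using g conditional_depends_only_on[of \<Lambda> \<omega> G f] f(1) unfolding depends_only_on_def by (auto simp: merge_def)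
  \<comment> \<open>Used in both directions: to split the integral of \<open>f x * g x\<close>, and
    to reassemble that of its conditional counterpart.\<close>
  have fold: "(\<integral>x. exp (- H \<Lambda> \<omega> x) * k x \<partial>P \<Lambda>)
      = (\<integral>x. \<integral>y. exp (- h x) * (exp (- H ?L (override G x \<omega>) y) * k (merge G ?L (x, y))) \<partial>P ?L \<partial>P G)"
    if "subexponential \<Lambda> k" for k
    using product_integral_fold[OF fin(3,1,2), of "\<lambda>x. exp (- H \<Lambda> \<omega> x) * k x"]
      integrable_exp_H_mult[OF assms(2) that, of \<omega>]
    by (simp add: Un_absorb1[OF assms(3)] Hm exp_add exp_diff exp_minus field_simps)
  have "(\<integral>x. exp (- H \<Lambda> \<omega> x) * (f x * g x) \<partial>P \<Lambda>)
     = (\<integral>x. exp (- h x) * ((\<integral>y. exp (- H ?L (override G x \<omega>) y) * f y \<partial>P ?L) * g x) \<partial>P G)"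
    unfolding fold[OF fg(1)] gm
    by (simp only: integral_mult_right_zero) (simp only: mult.assoc[symmetric] integral_mult_left_zero)
  also have "\<dots> = (\<integral>x. exp (- h x) * (Z ?L (override G x \<omega>) * (?f x * g x)) \<partial>P G)"
  proof (intro Bochner_Integration.integral_cong refl)
    fix x
    have "(\<integral>y. exp (- H ?L (override G x \<omega>) y) * f y \<partial>P ?L) = Z ?L (override G x \<omega>) * ?f x"
      unfolding conditional_def using integral_gibbs[OF fin(2) f(2)] Z_pos[OF fin(2), of "override G x \<omega>"]
      by simp
    then show "exp (- h x) * ((\<integral>y. exp (- H ?L (override G x \<omega>) y) * f y \<partial>P ?L) * g x)
      = exp (- h x) * (Z ?L (override G x \<omega>) * (?f x * g x))" by simp
  qed
  also have "\<dots> = (\<integral>x. exp (- H \<Lambda> \<omega> x) * (?f x * g x) \<partial>P \<Lambda>)"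
    unfolding fold[OF fg(2)] gm by (simp add: partition_function_def)
  finally show ?thesis
    using integral_gibbs[OF assms(2) subexponential_measurable[OF fg(1)]]
      integral_gibbs[OF assms(2) subexponential_measurable[OF fg(2)]] by simp
qed

lemma conditional_Lipschitz:
  assumes "tempered M \<Lambda> \<omega>" "finite \<Lambda>" "G \<subseteq> \<Lambda>"
    and step: "\<And>k \<omega>1 \<omega>2. k \<in> G \<Longrightarrow> tempered M (\<Lambda> - G) \<omega>1 \<Longrightarrow> tempered M (\<Lambda> - G) \<omega>2 \<Longrightarrow>
      (\<And>j. j \<notin> \<Lambda> - G \<Longrightarrow> j \<noteq> k \<Longrightarrow> \<omega>2 j = \<omega>1 j) \<Longrightarrow>
      \<bar>(\<integral>y. f y \<partial>\<mu> (\<Lambda> - G) \<omega>1) - (\<integral>y. f y \<partial>\<mu> (\<Lambda> - G) \<omega>2)\<bar> \<le> K * \<bar>\<omega>2 k - \<omega>1 k\<bar>"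
  shows "\<bar>conditional \<Lambda> \<omega> G f x - conditional \<Lambda> \<omega> G f y\<bar> \<le> K * (\<Sum>k\<in>G. \<bar>x k - y k\<bar>)"
proof -
  have G: "finite G" using assms finite_subset by blast
  have temp: "tempered M (\<Lambda> - G) (override G z \<omega>)" for z
    by (rule tempered_modify[OF assms(1), where B = G]) (use G in \<open>auto simp: override_def\<close>)
  have "\<bar>conditional \<Lambda> \<omega> G f x - conditional \<Lambda> \<omega> G f y\<bar> \<le> K * (\<Sum>k\<in>S. \<bar>x k - y k\<bar>)"
    if "finite S" "S \<subseteq> G" "\<forall>k\<in>G - S. x k = y k" for S
    using that
  proof (induction S arbitrary: x)
    case empty
    then have "override G x \<omega> = override G y \<omega>" by (auto simp: override_def)
    then show ?case by (simp add: conditional_def)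
  next
    case (insert k S)
    let ?x = "x(k := y k)"
    have "\<bar>conditional \<Lambda> \<omega> G f ?x - conditional \<Lambda> \<omega> G f y\<bar> \<le> K * (\<Sum>j\<in>S. \<bar>?x j - y j\<bar>)"
      using insert by (intro insert.IH) auto
    also have "(\<Sum>j\<in>S. \<bar>?x j - y j\<bar>) = (\<Sum>j\<in>S. \<bar>x j - y j\<bar>)"
      using insert by (intro sum.cong) auto
    finally have 1: "\<bar>conditional \<Lambda> \<omega> G f ?x - conditional \<Lambda> \<omega> G f y\<bar> \<le> K * (\<Sum>j\<in>S. \<bar>x j - y j\<bar>)" .
    have "\<bar>conditional \<Lambda> \<omega> G f x - conditional \<Lambda> \<omega> G f ?x\<bar> \<le> K * \<bar>override G ?x \<omega> k - override G x \<omega> k\<bar>"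
      unfolding conditional_def using insert by (intro step temp) (auto simp: override_def)
    also have "\<bar>override G ?x \<omega> k - override G x \<omega> k\<bar> = \<bar>x k - y k\<bar>"
      using insert by (simp add: override_def abs_minus_commute)
    finally show ?case
      using 1 insert(1,2) unfolding sum.insert[OF insert(1,2)] distrib_left by linarith
  qed
  from this[of G] show ?thesis using G by simp
qed

text \<open>The tower property serves twice: with the constant 1 for the mean of \<open>f\<close>,
  and with \<open>g\<close> for the mixed moment.\<close>

lemma cov_conditional:
  assumes "tempered M \<Lambda> \<omega>" "finite \<Lambda>" "G \<subseteq> \<Lambda>"
    and f: "depends_only_on f (\<Lambda> - G)" "f \<in> borel_measurable (P (\<Lambda> - G))" "subexponential \<Lambda> f"
    and cf: "subexponential \<Lambda> (conditional \<Lambda> \<omega> G f)"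
    and g: "depends_only_on g G" "subexponential \<Lambda> g"
  shows "cov (\<mu> \<Lambda> \<omega>) f g = cov (\<mu> \<Lambda> \<omega>) (conditional \<Lambda> \<omega> G f) g"
proof -
  interpret prob_space "\<mu> \<Lambda> \<omega>" by (rule prob_space_gibbs[OF assms(2)])
  have "expectation f = expectation (conditional \<Lambda> \<omega> G f)"
    using expectation_conditional[OF assms(1-3) f(1,2), of "\<lambda>x. 1"] f(3) cf
    by (simp add: depends_only_on_def)
  moreover have "expectation (\<lambda>x. f x * g x) = expectation (\<lambda>x. conditional \<Lambda> \<omega> G f x * g x)"
    by (intro expectation_conditional assms subexponential_mult)
  ultimately show ?thesis
    using cov_eq[of f g] cov_eq[of "conditional \<Lambda> \<omega> G f" g] f(3) cf g(2)
    by (simp add: integrable_gibbs[OF assms(2)] subexponential_mult)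
qed

section \<open>From (DS) to (DC)\<close>

lemma real_nat_powr_mono:
  assumes "a \<le> b" "a \<noteq> 0"
  shows "real n powr a \<le> real n powr b"
  using assms by (cases "n = 0") (auto intro: powr_mono)

lemma observable_cov_le:
  assumes "finite \<Lambda>" "observable \<Lambda> f" "observable \<Lambda> g"
  shows "\<bar>cov (\<mu> \<Lambda> \<omega>) f g\<bar>
    \<le> 2 * variance_bound * (grad_sup_norm \<Lambda> f * real (card (supp f))) * (grad_sup_norm \<Lambda> g * real (card (supp g)))"
  using assms
  by (intro cov_le grad_sup_norm_nonneg observable_Lipschitz observable_measurable supp_subset)
     (auto simp: observable_def)

theorem boundary_influence_imp_correlations:
  assumes "decay_of_boundary_influence \<psi> s M"
  shows "decay_of_correlations \<psi> s M"
proof -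
  let ?d = "real CARD('d)" and ?A = variance_bound
  obtain C \<alpha> \<beta> where pos: "C > 0" "\<alpha> > 0" "\<beta> > 0"
    and DS: "\<forall>\<Lambda> f i \<omega> \<omega>'. finite \<Lambda> \<and> observable \<Lambda> f \<and> i \<notin> \<Lambda> \<and> tempered M \<Lambda> \<omega> \<and> tempered M \<Lambda> \<omega>' \<and>
        (\<forall>k. k \<notin> \<Lambda> \<longrightarrow> k \<noteq> i \<longrightarrow> \<omega>' k = \<omega> k) \<longrightarrow>
        \<bar>(\<integral>x. f x \<partial>\<mu> \<Lambda> \<omega>) - (\<integral>x. f x \<partial>\<mu> \<Lambda> \<omega>')\<bar> \<le>
          C * (real (card (supp f)) powr \<beta>
               / (1 + real (site_dist (supp f) {i})) powr (?d + \<alpha>)) * \<bar>\<omega>' i - \<omega> i\<bar> * grad_sup_norm \<Lambda> f"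
    using assms unfolding decay_of_boundary_influence_def by (elim exE conjE)
  \<comment> \<open>At least 2, because after conditioning both functions depend on the spins in the
    support of \<open>g\<close>, whose cardinality enters squared.\<close>
  define \<beta>' where "\<beta>' = max \<beta> 2"
  \<comment> \<open>The summand \<open>C\<close> serves disjoint supports; the summand 1 serves
    overlapping ones, where the variance bound is used without (DS).\<close>
  define C' where "C' = 2 * ?A * (C + 1)"
  have C': "C' > 0" using pos variance_bound_pos by (simp add: C'_def)
  have card1: "real n \<le> real n powr \<beta>'" for n
    using real_nat_powr_mono[of 1 \<beta>' n] by (simp add: \<beta>'_def)
  have card2: "real n * real n \<le> real n powr \<beta>'" for n
    using real_nat_powr_mono[of 2 \<beta>' n] by (cases "n = 0") (simp_all add: \<beta>'_def power2_eq_square)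
  have bound: "\<bar>cov (\<mu> \<Lambda> \<omega>) f g\<bar> \<le>
      C' * (real (card (supp f)) powr \<beta>' * real (card (supp g)) powr \<beta>'
           / (1 + real (site_dist (supp f) (supp g))) powr (?d + \<alpha>))
         * grad_sup_norm \<Lambda> f * grad_sup_norm \<Lambda> g"
    if \<Lambda>: "finite \<Lambda>" "tempered M \<Lambda> \<omega>" "observable \<Lambda> f" "observable \<Lambda> g" for \<Lambda> \<omega> f g
  proof -
    let ?F = "supp f" and ?G = "supp g"
    let ?p = "(1 + real (site_dist ?F ?G)) powr (?d + \<alpha>)"
    let ?Lf = "grad_sup_norm \<Lambda> f" and ?Lg = "grad_sup_norm \<Lambda> g"
    have sub: "?F \<subseteq> \<Lambda>" "?G \<subseteq> \<Lambda>" using \<Lambda>(3,4) by (auto simp: observable_def dest: supp_subset)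
    have L: "?Lf \<ge> 0" "?Lg \<ge> 0" using \<Lambda> by (auto intro: grad_sup_norm_nonneg)
    note crude = observable_cov_le[OF \<Lambda>(1,3,4), of \<omega>]
    consider "?F = {} \<or> ?G = {}" | "?F \<inter> ?G \<noteq> {}" | "?F \<noteq> {}" "?G \<noteq> {}" "?F \<inter> ?G = {}" by blast
    then show ?thesis
    proof cases
      case 1
      \<comment> \<open>An empty support has cardinality 0, so the bound without decay is already
        0.\<close>
      then show ?thesis using crude by auto
    next
      case 2
      then obtain i where "i \<in> ?F" "i \<in> ?G" by auto
      then have p: "?p = 1" using site_dist_le[of i ?F i ?G] by simp
      have "2 * ?A * (?Lf * real (card ?F)) * (?Lg * real (card ?G))
          \<le> C' * (?Lf * real (card ?F) powr \<beta>') * (?Lg * real (card ?G) powr \<beta>')"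
        using pos variance_bound_pos L card1 by (intro mult_mono) (auto simp: C'_def)
      then show ?thesis using crude p by (simp add: mult_ac)
    next
      case 3
      let ?L = "\<Lambda> - ?G" and ?K = "C * (real (card ?F) powr \<beta> / ?p) * ?Lf"
      have G: "finite ?G" using sub \<Lambda>(1) finite_subset by blast
      have fL: "observable ?L f"
        using \<Lambda> sub 3 by (intro observable_restrict[OF \<Lambda>(1,3)]) auto
      have K: "?K \<ge> 0" using pos L by simp
      have lip: "\<bar>conditional \<Lambda> \<omega> ?G f x - conditional \<Lambda> \<omega> ?G f y\<bar> \<le> ?K * (\<Sum>k\<in>?G. \<bar>x k - y k\<bar>)" for x y
      proof (rule conditional_Lipschitz[OF \<Lambda>(2,1) sub(2)])
        fix k \<omega>1 \<omega>2
        assume k: "k \<in> ?G" and t: "tempered M ?L \<omega>1" "tempered M ?L \<omega>2" "\<And>j. j \<notin> ?L \<Longrightarrow> j \<noteq> k \<Longrightarrow> \<omega>2 j = \<omega>1 j"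
        obtain i where i: "i \<in> ?F" "site_dist ?F {k} = site_norm (i - k)"
          using site_dist_attained[OF 3(1), of "{k}"] by auto
        \<comment> \<open>A site of the support of \<open>g\<close> is at least as far from that of
          \<open>f\<close> as the whole support is, so one constant serves all
          \<open>k\<close>.\<close>
        have "site_dist ?F ?G \<le> site_dist ?F {k}" using site_dist_le[OF i(1) k] i(2) by simp
        then have "?p \<le> (1 + real (site_dist ?F {k})) powr (?d + \<alpha>)"
          using pos by (intro powr_mono2) auto
        then have q: "real (card ?F) powr \<beta> / (1 + real (site_dist ?F {k})) powr (?d + \<alpha>) \<le> real (card ?F) powr \<beta> / ?p"
          by (intro divide_left_mono) auto
        have "\<bar>(\<integral>y. f y \<partial>\<mu> ?L \<omega>1) - (\<integral>y. f y \<partial>\<mu> ?L \<omega>2)\<bar> \<le>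
          C * (real (card ?F) powr \<beta> / (1 + real (site_dist ?F {k})) powr (?d + \<alpha>)) * \<bar>\<omega>2 k - \<omega>1 k\<bar> * grad_sup_norm ?L f"
          using \<Lambda>(1) fL k t by (intro DS[rule_format]) auto
        also have "\<dots> \<le> C * (real (card ?F) powr \<beta> / ?p) * \<bar>\<omega>2 k - \<omega>1 k\<bar> * ?Lf"
          using pos q fL \<Lambda>(1) grad_sup_norm_restrict[OF \<Lambda>(1,3), of ?L]
          by (intro mult_mono mult_nonneg_nonneg) (auto intro!: grad_sup_norm_nonneg)
        finally show "\<bar>(\<integral>y. f y \<partial>\<mu> ?L \<omega>1) - (\<integral>y. f y \<partial>\<mu> ?L \<omega>2)\<bar> \<le> ?K * \<bar>\<omega>2 k - \<omega>1 k\<bar>"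
          by (simp add: mult_ac)
      qed
      have dep: "depends_only_on (conditional \<Lambda> \<omega> ?G f) \<Lambda>"
        using conditional_depends_only_on[of \<Lambda> \<omega> ?G f] sub(2) unfolding depends_only_on_def by blast
      have cm: "conditional \<Lambda> \<omega> ?G f \<in> borel_measurable (P \<Lambda>)"
        by (rule continuous_measurable_PiM[OF Lipschitz_continuous_on dep]) (rule lip)
      \<comment> \<open>\<open>cov_le\<close> is applied with both sets equal to the support of
        \<open>g\<close>.\<close>
      have "\<bar>cov (\<mu> \<Lambda> \<omega>) (conditional \<Lambda> \<omega> ?G f) g\<bar>
          \<le> 2 * ?A * (?K * real (card ?G)) * (?Lg * real (card ?G))"
        by (rule cov_le[OF \<Lambda>(1) sub(2,2) K L(2) cm lip observable_measurable[OF \<Lambda>(4)]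
              observable_Lipschitz[OF \<Lambda>(1,4)]])
      also have "cov (\<mu> \<Lambda> \<omega>) (conditional \<Lambda> \<omega> ?G f) g = cov (\<mu> \<Lambda> \<omega>) f g"
      proof (rule cov_conditional[OF \<Lambda>(2,1) sub(2), symmetric])
        show "depends_only_on f ?L" using fL by (simp add: observable_def)
        show "f \<in> borel_measurable (P ?L)" by (rule observable_measurable[OF fL])
        show "subexponential \<Lambda> (conditional \<Lambda> \<omega> ?G f)"
          by (rule subexponential_Lipschitz[OF \<Lambda>(1) sub(2) cm, where m = "\<lambda>_. 0"]) (rule lip)
        show "depends_only_on g ?G" by (rule observable_depends_only_on_supp[OF \<Lambda>(1,4)])
      qed (use \<Lambda> in \<open>auto intro: subexponential_observable\<close>)
      also have "2 * ?A * (?K * real (card ?G)) * (?Lg * real (card ?G))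
          = (2 * ?A * C / ?p * ?Lf * ?Lg) * (real (card ?F) powr \<beta> * (real (card ?G) * real (card ?G)))"
        by simp
      also have "\<dots> \<le> (C' / ?p * ?Lf * ?Lg) * (real (card ?F) powr \<beta>' * real (card ?G) powr \<beta>')"
        using pos variance_bound_pos L card2 real_nat_powr_mono[of \<beta> \<beta>']
        by (intro mult_mono divide_right_mono mult_nonneg_nonneg) (auto simp: C'_def \<beta>'_def)
      finally show ?thesis by (simp add: mult_ac)
    qed
  qed
  show ?thesis
    unfolding decay_of_correlations_def
    by (intro exI[of _ C'] exI[of _ \<alpha>] exI[of _ \<beta>'] conjI allI impI)
       (use C' pos bound in \<open>auto simp: \<beta>'_def\<close>)
qed

end

subsection \<open>Differentiation in the boundary condition\<close>

lemma abs_exp_minus_one_le: "\<bar>exp z - 1\<bar> \<le> \<bar>z\<bar> * exp \<bar>z\<bar>" for z :: real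
proof -
  have "exp z * (1 - z) \<le> exp z * exp (- z)"
    using exp_ge_add_one_self[of "- z"] by (intro mult_left_mono) auto
  then have "exp z - 1 \<le> z * exp z" by (simp add: algebra_simps flip: exp_add)
  also have "\<dots> \<le> \<bar>z\<bar> * exp \<bar>z\<bar>" by (intro mult_mono) auto
  finally have "exp z - 1 \<le> \<bar>z\<bar> * exp \<bar>z\<bar>" .
  moreover have "- (\<bar>z\<bar> * exp \<bar>z\<bar>) \<le> exp z - 1"
  proof -
    have "\<bar>z\<bar> * 1 \<le> \<bar>z\<bar> * exp \<bar>z\<bar>" by (intro mult_left_mono) auto
    then show ?thesis using exp_ge_add_one_self[of z] by linarith
  qed
  ultimately show ?thesis by linarith
qed

text \<open>The quotients \<open>(exp (t * h x) - 1) / t\<close> with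
  \<open>\<bar>t\<bar> \<le> 1\<close> are at most
  \<open>\<bar>h x\<bar> * exp \<bar>h x\<bar>\<close> in absolute value, so dominated convergence
  applies with the majorant in \<open>dom\<close>.\<close>

lemma has_real_derivative_exp_integral:
  fixes k h w :: "'a \<Rightarrow> real"
  assumes meas: "w \<in> borel_measurable N" "k \<in> borel_measurable N" "h \<in> borel_measurable N"
    and int: "integrable N (\<lambda>x. w x * k x)"
    and dom: "integrable N (\<lambda>x. w x * (\<bar>k x\<bar> * \<bar>h x\<bar> * exp \<bar>h x\<bar>))"
    and w: "\<And>x. w x \<ge> 0"
  shows "((\<lambda>t. \<integral>x. w x * exp (t * h x) * k x \<partial>N) has_real_derivative (\<integral>x. w x * (k x * h x) \<partial>N)) (at 0)"
proof -
  let ?g = "\<lambda>t. \<integral>x. w x * exp (t * h x) * k x \<partial>N"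
  let ?q = "\<lambda>t x. w x * k x * ((exp (t * h x) - 1) / t)"
  have bound: "\<bar>?q t x\<bar> \<le> w x * (\<bar>k x\<bar> * \<bar>h x\<bar> * exp \<bar>h x\<bar>)" if "t \<noteq> 0" "\<bar>t\<bar> \<le> 1" for t x
  proof -
    have "\<bar>exp (t * h x) - 1\<bar> \<le> \<bar>t\<bar> * \<bar>h x\<bar> * exp \<bar>t * h x\<bar>"
      using abs_exp_minus_one_le[of "t * h x"] by (simp add: abs_mult)
    also have "\<dots> \<le> \<bar>t\<bar> * \<bar>h x\<bar> * exp \<bar>h x\<bar>"
      using that by (intro mult_left_mono) (auto simp: abs_mult mult_left_le_one_le)
    finally have "\<bar>(exp (t * h x) - 1) / t\<bar> \<le> \<bar>h x\<bar> * exp \<bar>h x\<bar>"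
      using that by (simp add: field_simps)
    then have "w x * \<bar>k x\<bar> * \<bar>(exp (t * h x) - 1) / t\<bar> \<le> w x * \<bar>k x\<bar> * (\<bar>h x\<bar> * exp \<bar>h x\<bar>)"
      using w by (intro mult_left_mono) auto
    then show ?thesis using w[of x] by (simp add: abs_mult mult_ac)
  qed
  have iq: "integrable N (?q t)" if "t \<noteq> 0" "\<bar>t\<bar> \<le> 1" for t
  proof (rule Bochner_Integration.integrable_bound[OF dom])
    show "?q t \<in> borel_measurable N" using meas by measurable
    show "AE x in N. norm (?q t x) \<le> norm (w x * (\<bar>k x\<bar> * \<bar>h x\<bar> * exp \<bar>h x\<bar>))"
      using bound[OF that] by (intro AE_I2) (simp only: real_norm_def, rule order_trans[OF _ abs_ge_self])
  qed
  have quotient: "(?g (0 + t) - ?g 0) / t = (\<integral>x. ?q t x \<partial>N)" if "t \<noteq> 0" "\<bar>t\<bar> \<le> 1" for t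
  proof -
    \<comment> \<open>In this form the integrand at \<open>t\<close> inherits integrability from the
      quotient and from the integrand at 0.\<close>
    have eq: "w x * exp (t * h x) * k x = t * ?q t x + w x * k x" for x
      using that by (simp add: field_simps)
    have "?g t = t * (\<integral>x. ?q t x \<partial>N) + (\<integral>x. w x * k x \<partial>N)"
      unfolding eq using iq[OF that] int
      by (subst Bochner_Integration.integral_add) (simp_all only: integrable_mult_right integral_mult_right_zero)
    then show ?thesis using that by simp
  qed
  \<comment> \<open>Restricting to this interval keeps \<open>\<bar>t\<bar> \<le> 1\<close> along
    every sequence; as the interval is open, the filter at 0 stays the same.\<close>
  have "((\<lambda>t. (?g (0 + t) - ?g 0) / t) \<longlongrightarrow> (\<integral>x. w x * (k x * h x) \<partial>N)) (at 0 within {-1<..<1})"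
    unfolding tendsto_at_iff_sequentially
  proof (intro allI impI)
    fix X :: "nat \<Rightarrow> real" assume X: "\<forall>n. X n \<in> {-1<..<1} - {0}" "X \<longlonglongrightarrow> 0"
    have X': "X n \<noteq> 0" "\<bar>X n\<bar> \<le> 1" for n using X(1)[rule_format, of n] by (auto simp: abs_le_iff)
    have "(\<lambda>n. \<integral>x. ?q (X n) x \<partial>N) \<longlonglongrightarrow> (\<integral>x. w x * (k x * h x) \<partial>N)"
    proof (rule integral_dominated_convergence[OF _ _ dom])
      have "(\<lambda>n. ?q (X n) x) \<longlonglongrightarrow> w x * (k x * h x)" for x
      proof -
        have "((\<lambda>t. exp (t * h x)) has_real_derivative h x) (at 0)"
          using DERIV_fun_exp[OF DERIV_cmult_right[OF DERIV_ident, of "h x" 0]] by simp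
        then have "((\<lambda>t. (exp (t * h x) - 1) / t) \<longlongrightarrow> h x) (at 0)"
          unfolding DERIV_def add_0 mult_zero_left exp_zero .
        moreover have "filterlim X (at 0) sequentially"
          using X(2) X'(1) by (simp add: filterlim_at)
        ultimately have "(\<lambda>n. (exp (X n * h x) - 1) / X n) \<longlonglongrightarrow> h x"
          by (rule filterlim_compose[where f = X])
        then have "(\<lambda>n. ?q (X n) x) \<longlonglongrightarrow> w x * k x * h x"
          by (rule tendsto_mult[OF tendsto_const])
        then show ?thesis by (simp add: mult.assoc)
      qed
      then show "AE x in N. (\<lambda>n. ?q (X n) x) \<longlonglongrightarrow> w x * (k x * h x)" by simp
      show "AE x in N. norm (?q (X n) x) \<le> w x * (\<bar>k x\<bar> * \<bar>h x\<bar> * exp \<bar>h x\<bar>)" for n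
        by (intro AE_I2) (simp only: real_norm_def bound[OF X'])
      show "(\<lambda>x. w x * (k x * h x)) \<in> borel_measurable N" using meas by measurable
      show "?q (X n) \<in> borel_measurable N" for n using meas by measurable
    qed
    then show "((\<lambda>t. (?g (0 + t) - ?g 0) / t) \<circ> X) \<longlonglongrightarrow> (\<integral>x. w x * (k x * h x) \<partial>N)"
      unfolding o_def quotient[OF X'] .
  qed
  moreover have "at 0 within {-1<..<1} = at (0 :: real)" by (rule at_within_open) auto
  ultimately show ?thesis unfolding DERIV_def by (simp only:)
qed

section \<open>Response of expectations to one boundary spin\<close>

text \<open>Temperedness allows the term at \<open>i\<close> to be split off: a divergent
  \<open>infsum\<close> would be 0 both before and after the update.\<close>

lemma boundary_field_update:
  assumes "tempered M \<Lambda> \<omega>" "i \<notin> \<Lambda>" "j \<in> \<Lambda>"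
  shows "boundary_field M \<Lambda> (\<omega> (i := r)) j = boundary_field M \<Lambda> \<omega> j + M j i * (r - \<omega> i)"
proof -
  let ?B = "- \<Lambda> - {i}"
  have eq: "- \<Lambda> = insert i ?B" using assms(2) by auto
  have "(\<lambda>k. M j k * \<omega> k) summable_on ?B"
    using tempered_summable[OF assms(1,3)] by (rule summable_on_subset_banach) auto
  moreover have "(\<lambda>k. M j k * (\<omega> (i := r)) k) summable_on ?B \<longleftrightarrow> (\<lambda>k. M j k * \<omega> k) summable_on ?B"
    by (rule summable_on_cong) auto
  ultimately have s: "(\<lambda>k. M j k * \<omega> k) summable_on ?B" "(\<lambda>k. M j k * (\<omega> (i := r)) k) summable_on ?B"
    by blast+
  have "boundary_field M \<Lambda> \<omega>' j = M j i * \<omega>' i + (\<Sum>\<^sub>\<infinity>k\<in>?B. M j k * \<omega>' k)"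
    if "(\<lambda>k. M j k * \<omega>' k) summable_on ?B" for \<omega>'
    unfolding boundary_field_def using infsum_insert[OF that, of i] by (simp only: eq[symmetric]) simp
  note this[OF s(1)] this[OF s(2)]
  moreover have "(\<Sum>\<^sub>\<infinity>k\<in>?B. M j k * (\<omega> (i := r)) k) = (\<Sum>\<^sub>\<infinity>k\<in>?B. M j k * \<omega> k)"
    by (rule infsum_cong) auto
  ultimately show ?thesis unfolding right_diff_distrib fun_upd_same by linarith
qed

context spin_system begin

lemma H_boundary_update:
  assumes "tempered M \<Lambda> \<omega>" "i \<notin> \<Lambda>"
  shows "H \<Lambda> (\<omega> (i := r)) x = H \<Lambda> \<omega> x + (r - \<omega> i) * (2 * (\<Sum>j\<in>\<Lambda>. M j i * x j))"
proof -
  have "(\<Sum>j\<in>\<Lambda>. \<psi> j (x j) + (s j + 2 * boundary_field M \<Lambda> (\<omega> (i := r)) j) * x j)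
    = (\<Sum>j\<in>\<Lambda>. \<psi> j (x j) + (s j + 2 * boundary_field M \<Lambda> \<omega> j) * x j) + (r - \<omega> i) * (2 * (\<Sum>j\<in>\<Lambda>. M j i * x j))"
    unfolding sum_distrib_left sum.distrib[symmetric]
    by (intro sum.cong refl) (simp add: boundary_field_update[OF assms] algebra_simps)
  then show ?thesis by (simp add: hamiltonian_eq)
qed

lemma tempered_update:
  assumes "tempered M \<Lambda> \<omega>"
  shows "tempered M \<Lambda> (\<omega> (i := r))"
  by (rule tempered_modify[OF assms, where B = "{i}"]) auto

lemma subexponential_exp_linear:
  fixes \<Lambda> :: "'d site set"
  assumes "finite \<Lambda>"
  shows "subexponential \<Lambda> (\<lambda>x. exp \<bar>\<Sum>j\<in>\<Lambda>. a j * x j\<bar>)"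
proof (rule subexponential_exp[where c = "\<Sum>j\<in>\<Lambda>. \<bar>a j\<bar>"])
  show "(\<lambda>x. \<bar>\<Sum>j\<in>\<Lambda>. a j * x j\<bar>) \<in> borel_measurable (P \<Lambda>)"
    by (intro borel_measurable_abs borel_measurable_sum borel_measurable_times borel_measurable_const coordinate_measurable)
  show "\<bar>\<bar>\<Sum>j\<in>\<Lambda>. a j * x j\<bar>\<bar> \<le> (\<Sum>j\<in>\<Lambda>. \<bar>a j\<bar>) * (\<Sum>i\<in>\<Lambda>. \<bar>x i\<bar>)" for x
  proof -
    have "\<bar>\<Sum>j\<in>\<Lambda>. a j * x j\<bar> \<le> (\<Sum>j\<in>\<Lambda>. \<bar>a j\<bar> * \<bar>x j\<bar>)" 
      using sum_abs[of "\<lambda>j. a j * x j" \<Lambda>] by (simp add: abs_mult)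
    also have "\<dots> \<le> (\<Sum>j\<in>\<Lambda>. \<bar>a j\<bar> * (\<Sum>i\<in>\<Lambda>. \<bar>x i\<bar>))"
      using assms by (intro sum_mono mult_left_mono member_le_sum) auto
    finally show ?thesis by (simp add: sum_distrib_right)
  qed
qed (simp add: sum_nonneg)

text \<open>The energy is affine in the boundary spin with slope \<open>- h\<close>, so
  differentiating the numerator and the partition function inserts a factor \<open>h\<close>. The
  quotient rule combines them into the covariance of \<open>f\<close> and \<open>h\<close>.\<close>

lemma DERIV_expectation_boundary:
  assumes "tempered M \<Lambda> \<omega>" "finite \<Lambda>" "i \<notin> \<Lambda>" "subexponential \<Lambda> f"
  shows "((\<lambda>r. \<integral>x. f x \<partial>\<mu> \<Lambda> (\<omega> (i := r))) has_real_derivative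
     - 2 * (\<Sum>j\<in>\<Lambda>. M j i * cov (\<mu> \<Lambda> (\<omega> (i := r))) f (\<lambda>x. x j))) (at r)"
proof -
  let ?\<omega> = "\<omega> (i := r)"
  let ?E = "\<lambda>k :: 'd config \<Rightarrow> real. \<integral>x. k x \<partial>\<mu> \<Lambda> ?\<omega>"
  define h where "h x = (\<Sum>j\<in>\<Lambda>. (- 2 * M j i) * x j)" for x
  have temp: "tempered M \<Lambda> ?\<omega>" by (rule tempered_update[OF assms(1)])
  interpret prob_space "\<mu> \<Lambda> ?\<omega>" by (rule prob_space_gibbs[OF assms(2)])
  have sh: "subexponential \<Lambda> h" unfolding h_def[abs_def]
    by (intro subexponential_intros assms(2))
  have she: "subexponential \<Lambda> (\<lambda>x. exp \<bar>h x\<bar>)" unfolding h_def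
    by (rule subexponential_exp_linear[OF assms(2)])
  have Zpos: "Z \<Lambda> ?\<omega> > 0" by (rule Z_pos[OF assms(2)])
  \<comment> \<open>Centred at \<open>r\<close>, so that differentiation at \<open>t = 0\<close>
    suffices; \<open>DERIV_shift\<close> moves the result to \<open>r\<close> at the end.\<close>
  have weight: "exp (- H \<Lambda> (\<omega> (i := r + t)) x) = exp (- H \<Lambda> ?\<omega> x) * exp (t * h x)" for t x
  proof -
    have "H \<Lambda> (?\<omega> (i := r + t)) x = H \<Lambda> ?\<omega> x - t * h x"
      unfolding H_boundary_update[OF temp assms(3)] by (simp add: h_def sum_distrib_left sum_negf mult_ac)
    then show ?thesis by (simp flip: exp_add)
  qed
  have deriv: "((\<lambda>t. \<integral>x. exp (- H \<Lambda> (\<omega> (i := r + t)) x) * k x \<partial>P \<Lambda>)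
     has_real_derivative Z \<Lambda> ?\<omega> * ?E (\<lambda>x. k x * h x)) (at 0)" if k: "subexponential \<Lambda> k" for k
  proof -
    have "((\<lambda>t. \<integral>x. exp (- H \<Lambda> ?\<omega> x) * exp (t * h x) * k x \<partial>P \<Lambda>)
      has_real_derivative (\<integral>x. exp (- H \<Lambda> ?\<omega> x) * (k x * h x) \<partial>P \<Lambda>)) (at 0)"
    proof (rule has_real_derivative_exp_integral)
      show "(\<lambda>x. exp (- H \<Lambda> ?\<omega> x)) \<in> borel_measurable (P \<Lambda>)" using H_measurable by measurable
    qed (auto intro!: integrable_exp_H_mult assms(2) subexponential_intros k sh she subexponential_measurable)
    then show ?thesis
      unfolding weight using Zpos
      by (simp add: integral_gibbs[OF assms(2) subexponential_measurable[OF subexponential_mult[OF k sh]]])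
  qed
  have N0: "(\<integral>x. exp (- H \<Lambda> (\<omega> (i := r + 0)) x) * k x \<partial>P \<Lambda>) = Z \<Lambda> ?\<omega> * ?E k" if "subexponential \<Lambda> k" for k
    using Zpos integral_gibbs[OF assms(2) subexponential_measurable[OF that]] by simp
  \<comment> \<open>The partition function is the case of the constant 1.\<close>
  let ?N = "\<lambda>k t. \<integral>x. exp (- H \<Lambda> (\<omega> (i := r + t)) x) * k x \<partial>P \<Lambda>"
  have "((\<lambda>t. ?N f t / ?N (\<lambda>_. 1) t) has_real_derivative
     (Z \<Lambda> ?\<omega> * ?E (\<lambda>x. f x * h x) * ?N (\<lambda>_. 1) 0 - ?N f 0 * (Z \<Lambda> ?\<omega> * ?E (\<lambda>x. 1 * h x))) / (?N (\<lambda>_. 1) 0 * ?N (\<lambda>_. 1) 0)) (at 0)"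
    by (intro DERIV_divide deriv assms(4) subexponential_const)
       (use Zpos in \<open>simp only: N0[OF subexponential_const], simp add: prob_space\<close>)
  also have "(Z \<Lambda> ?\<omega> * ?E (\<lambda>x. f x * h x) * ?N (\<lambda>_. 1) 0 - ?N f 0 * (Z \<Lambda> ?\<omega> * ?E (\<lambda>x. 1 * h x))) / (?N (\<lambda>_. 1) 0 * ?N (\<lambda>_. 1) 0)
     = ?E (\<lambda>x. f x * h x) - ?E f * ?E h"
    unfolding N0[OF subexponential_const] N0[OF assms(4)] using Zpos
    by (simp add: prob_space field_simps)
  also have "(\<lambda>t. ?N f t / ?N (\<lambda>_. 1) t) = (\<lambda>t. \<integral>x. f x \<partial>\<mu> \<Lambda> (\<omega> (i := t + r)))"
    using integral_gibbs[OF assms(2) subexponential_measurable[OF assms(4)]]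
    by (simp add: partition_function_def add.commute)
  finally have D: "((\<lambda>t. \<integral>x. f x \<partial>\<mu> \<Lambda> (\<omega> (i := t))) has_real_derivative ?E (\<lambda>x. f x * h x) - ?E f * ?E h) (at r)"
    using DERIV_shift[of "\<lambda>t. \<integral>x. f x \<partial>\<mu> \<Lambda> (\<omega> (i := t))" _ 0 r] by (simp del: fun_upd_apply)
  have ij: "integrable (\<mu> \<Lambda> ?\<omega>) (\<lambda>x. x j)" "integrable (\<mu> \<Lambda> ?\<omega>) (\<lambda>x. f x * x j)" if "j \<in> \<Lambda>" for j
    by (intro integrable_gibbs subexponential_intros assms that)+
  have "?E (\<lambda>x. f x * h x) = (\<Sum>j\<in>\<Lambda>. - 2 * M j i * ?E (\<lambda>x. f x * x j))"
  proof -
    have "?E (\<lambda>x. f x * h x) = ?E (\<lambda>x. \<Sum>j\<in>\<Lambda>. - 2 * M j i * (f x * x j))"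
      by (simp add: h_def sum_distrib_left mult_ac)
    also have "\<dots> = (\<Sum>j\<in>\<Lambda>. ?E (\<lambda>x. - 2 * M j i * (f x * x j)))"
      by (intro Bochner_Integration.integral_sum integrable_mult_right ij)
    finally show ?thesis by simp
  qed
  moreover have "?E h = (\<Sum>j\<in>\<Lambda>. - 2 * M j i * ?E (\<lambda>x. x j))"
  proof -
    have "?E h = (\<Sum>j\<in>\<Lambda>. ?E (\<lambda>x. - 2 * M j i * x j))"
      unfolding h_def by (intro Bochner_Integration.integral_sum integrable_mult_right ij)
    then show ?thesis by simp
  qed
  moreover have "cov (\<mu> \<Lambda> ?\<omega>) f (\<lambda>x. x j) = ?E (\<lambda>x. f x * x j) - ?E f * ?E (\<lambda>x. x j)" if "j \<in> \<Lambda>" for j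
    by (intro cov_eq ij that integrable_gibbs assms)
  ultimately have "?E (\<lambda>x. f x * h x) - ?E f * ?E h = - 2 * (\<Sum>j\<in>\<Lambda>. M j i * cov (\<mu> \<Lambda> ?\<omega>) f (\<lambda>x. x j))"
    by (simp add: sum_distrib_left sum_negf sum_subtractf right_diff_distrib mult_ac)
  then show ?thesis using D by simp
qed

section \<open>From (DC) to (DS)\<close>

theorem correlations_imp_boundary_influence:
  assumes "CM > 0" "\<alpha>M > 0"
    and M_decay: "\<And>i j. \<bar>M i j\<bar> \<le> CM * (1 + real (site_norm (i - j))) powr (- (2 * real CARD('d) + \<alpha>M))"
    and DC: "decay_of_correlations \<psi> s M"
  shows "decay_of_boundary_influence \<psi> s M"
proof -
  let ?d = "real CARD('d)"
  obtain C \<alpha> \<beta> where pos: "C > 0" "\<alpha> > 0" "\<beta> > 0"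
    and DC: "\<forall>\<Lambda> \<omega> f g.
        finite \<Lambda> \<and> tempered M \<Lambda> \<omega> \<and> observable \<Lambda> f \<and> observable \<Lambda> g \<longrightarrow>
        \<bar>cov (\<mu> \<Lambda> \<omega>) f g\<bar> \<le>
          C * (real (card (supp f)) powr \<beta> * real (card (supp g)) powr \<beta>
               / (1 + real (site_dist (supp f) (supp g))) powr (?d + \<alpha>))
            * grad_sup_norm \<Lambda> f * grad_sup_norm \<Lambda> g"
    using DC unfolding decay_of_correlations_def by (elim exE conjE)
  \<comment> \<open>The exponent \<open>2 d + \<alpha>M\<close> is split: \<open>d + \<alpha>'\<close> moves the distance from \<open>j\<close> to \<open>i\<close> by the triangle
    inequality, and the remaining \<open>d + \<alpha>M / 2\<close> makes the sum over \<open>j\<close> converge.\<close>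
  define \<alpha>' where "\<alpha>' = min \<alpha> (\<alpha>M / 2)"
  have \<alpha>': "\<alpha>' > 0" "\<alpha>' \<le> \<alpha>" "\<alpha>' \<le> \<alpha>M / 2" using pos assms(2) by (auto simp: \<alpha>'_def)
  have "\<alpha>M / 2 > 0" using assms(2) by simp
  from lattice_sum_bounded[OF this, where 'd = 'd]
  obtain S0 where S0: "\<forall>A. finite A \<longrightarrow>
      (\<Sum>k\<in>A. (1 + real (site_norm (k :: 'd site))) powr (- (?d + \<alpha>M / 2))) \<le> S0"
    by (elim exE)
  have S0_nonneg: "S0 \<ge> 0" using S0[rule_format, of "{}"] by simp
  \<comment> \<open>The injection \<open>j \<mapsto> i - j\<close> carries \<Lambda> to a finite
    set, so the bound is uniform in \<Lambda> and in \<open>i\<close>.\<close>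
  have S: "(\<Sum>j\<in>\<Lambda>. (1 + real (site_norm (i - j))) powr (- (?d + \<alpha>M / 2))) \<le> S0" if "finite \<Lambda>" for \<Lambda> and i :: "'d site"
    using S0[rule_format, of "(\<lambda>j. i - j) ` \<Lambda>"] that by (simp add: sum.reindex inj_on_def)
  \<comment> \<open>The 2 comes from the derivative in the boundary spin; \<open>S0 + 1\<close>
    replaces \<open>S0\<close> to ensure positivity.\<close>
  define C' where "C' = 2 * C * CM * (S0 + 1)"
  have C': "C' > 0" using pos assms(1) S0_nonneg by (simp add: C'_def)
  have bound: "\<bar>(\<integral>x. f x \<partial>\<mu> \<Lambda> \<omega>) - (\<integral>x. f x \<partial>\<mu> \<Lambda> \<omega>')\<bar> \<le>
          C' * (real (card (supp f)) powr \<beta>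
               / (1 + real (site_dist (supp f) {i})) powr (?d + \<alpha>')) * \<bar>\<omega>' i - \<omega> i\<bar> * grad_sup_norm \<Lambda> f"
    if \<Lambda>: "finite \<Lambda>" "observable \<Lambda> f" "i \<notin> \<Lambda>" "tempered M \<Lambda> \<omega>"
      and \<omega>': "\<And>k. k \<notin> \<Lambda> \<Longrightarrow> k \<noteq> i \<Longrightarrow> \<omega>' k = \<omega> k" for \<Lambda> f i \<omega> \<omega>'
  proof -
    let ?F = "supp f" and ?L = "grad_sup_norm \<Lambda> f"
    let ?n = "\<lambda>j. 1 + real (site_norm (i - j))" and ?D = "\<lambda>j. 1 + real (site_dist ?F {j})"
    let ?Q = "C * CM * real (card ?F) powr \<beta> * ?L"
    define K where "K = C' * (real (card ?F) powr \<beta> / ?D i powr (?d + \<alpha>')) * ?L"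
    have L: "?L \<ge> 0" using \<Lambda> by (auto intro: grad_sup_norm_nonneg)
    have term_le: "\<bar>M j i * cov (\<mu> \<Lambda> (\<omega> (i := r))) f (\<lambda>x. x j)\<bar>
        \<le> ?Q * (?D i powr (- (?d + \<alpha>')) * ?n j powr (- (?d + \<alpha>M / 2)))" if j: "j \<in> \<Lambda>" for j r
    proof (cases "?F = {}")
      \<comment> \<open>An observable with empty support has covariance 0 with every spin; it is
        treated apart because \<open>site_dist_powr_triangle\<close> is stated for nonempty
        sets.\<close>
      case True
      have "\<bar>cov (\<mu> \<Lambda> (\<omega> (i := r))) f (\<lambda>x. x j)\<bar> \<le> 0"
        using observable_cov_le[OF \<Lambda>(1,2) observable_coordinate[OF j], of "\<omega> (i := r)"] True by simp
      then show ?thesis using True by simp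
    next
      case False
      \<comment> \<open>(DC) with a single spin as second function: its support has one element and
        its gradient norm is 1.\<close>
      have "\<bar>cov (\<mu> \<Lambda> (\<omega> (i := r))) f (\<lambda>x. x j)\<bar> \<le>
          C * (real (card ?F) powr \<beta> * real (card (supp (\<lambda>x :: 'd config. x j))) powr \<beta>
               / (1 + real (site_dist ?F (supp (\<lambda>x. x j)))) powr (?d + \<alpha>)) * ?L * grad_sup_norm \<Lambda> (\<lambda>x. x j)"
        using \<Lambda> j by (intro DC[rule_format]) (auto intro: observable_coordinate tempered_update)
      also have "\<dots> = (C * real (card ?F) powr \<beta> * ?L) * inverse (?D j powr (?d + \<alpha>))"
        using \<Lambda>(1) j by (simp add: supp_coordinate grad_sup_norm_coordinate divide_inverse mult_ac)
      also have "\<dots> = (C * real (card ?F) powr \<beta> * ?L) * ?D j powr (- (?d + \<alpha>))"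
        by (simp only: powr_minus)
      also have "\<dots> \<le> (C * real (card ?F) powr \<beta> * ?L) * ?D j powr (- (?d + \<alpha>'))"
        using pos L \<alpha>' by (intro mult_left_mono powr_mono) auto
      finally have c: "\<bar>cov (\<mu> \<Lambda> (\<omega> (i := r))) f (\<lambda>x. x j)\<bar> \<le> (C * real (card ?F) powr \<beta> * ?L) * ?D j powr (- (?d + \<alpha>'))" .
      have "\<bar>M j i\<bar> \<le> CM * ?n j powr (- (2 * ?d + \<alpha>M))" using M_decay[of i j] by (simp add: M_sym[of j i])
      also have "\<dots> \<le> CM * ?n j powr ((- (?d + \<alpha>')) + (- (?d + \<alpha>M / 2)))"
        using assms(1) \<alpha>' by (intro mult_left_mono powr_mono) auto
      also have "\<dots> = CM * (?n j powr (- (?d + \<alpha>')) * ?n j powr (- (?d + \<alpha>M / 2)))"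
        by (simp only: powr_add)
      finally have "\<bar>M j i\<bar> \<le> CM * (?n j powr (- (?d + \<alpha>')) * ?n j powr (- (?d + \<alpha>M / 2)))" .
      then have "\<bar>M j i * cov (\<mu> \<Lambda> (\<omega> (i := r))) f (\<lambda>x. x j)\<bar>
        \<le> (CM * (?n j powr (- (?d + \<alpha>')) * ?n j powr (- (?d + \<alpha>M / 2)))) * ((C * real (card ?F) powr \<beta> * ?L) * ?D j powr (- (?d + \<alpha>')))"
        unfolding abs_mult using c assms(1) by (intro mult_mono) auto
      also have "\<dots> = (?Q * ?n j powr (- (?d + \<alpha>M / 2))) * (?n j powr (- (?d + \<alpha>')) * ?D j powr (- (?d + \<alpha>')))"
        by (simp only: mult_ac)
      also have "\<dots> \<le> (?Q * ?n j powr (- (?d + \<alpha>M / 2))) * ?D i powr (- (?d + \<alpha>'))"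
        using pos assms(1) L \<alpha>' by (intro mult_left_mono site_dist_powr_triangle[OF False]) auto
      finally show ?thesis by (simp only: mult_ac)
    qed
    have K: "\<bar>- 2 * (\<Sum>j\<in>\<Lambda>. M j i * cov (\<mu> \<Lambda> (\<omega> (i := r))) f (\<lambda>x. x j))\<bar> \<le> K" for r
    proof -
      have "\<bar>\<Sum>j\<in>\<Lambda>. M j i * cov (\<mu> \<Lambda> (\<omega> (i := r))) f (\<lambda>x. x j)\<bar>
         \<le> (\<Sum>j\<in>\<Lambda>. ?Q * (?D i powr (- (?d + \<alpha>')) * ?n j powr (- (?d + \<alpha>M / 2))))"
        using term_le by (intro order_trans[OF sum_abs sum_mono])
      also have "\<dots> = (?Q * ?D i powr (- (?d + \<alpha>'))) * (\<Sum>j\<in>\<Lambda>. ?n j powr (- (?d + \<alpha>M / 2)))"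
        by (simp only: sum_distrib_left mult.assoc)
      also have "\<dots> \<le> (?Q * ?D i powr (- (?d + \<alpha>'))) * (S0 + 1)"
        using S[OF \<Lambda>(1), of i] pos assms(1) L by (intro mult_left_mono) auto
      finally have "2 * \<bar>\<Sum>j\<in>\<Lambda>. M j i * cov (\<mu> \<Lambda> (\<omega> (i := r))) f (\<lambda>x. x j)\<bar>
         \<le> 2 * ((?Q * ?D i powr (- (?d + \<alpha>'))) * (S0 + 1))" by simp
      also have "\<dots> = K" unfolding K_def C'_def powr_minus divide_inverse by (simp only: mult_ac)
      finally show ?thesis by (simp only: abs_mult abs_neg_numeral)
    qed
    let ?\<phi> = "\<lambda>r. \<integral>x. f x \<partial>\<mu> \<Lambda> (\<omega> (i := r))"
    \<comment> \<open>Mean value inequality as the boundary spin moves from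
      \<open>\<omega> i\<close> to \<open>\<omega>' i\<close>; \<open>K\<close> bounds the
      derivative for every value in between.\<close>
    have "norm (?\<phi> (\<omega> i) - ?\<phi> (\<omega>' i)) \<le> K * norm (\<omega> i - \<omega>' i)"
    proof (rule field_differentiable_bound[where S = UNIV])
      show "(?\<phi> has_field_derivative - 2 * (\<Sum>j\<in>\<Lambda>. M j i * cov (\<mu> \<Lambda> (\<omega> (i := r))) f (\<lambda>x. x j))) (at r within UNIV)" for r
        using DERIV_expectation_boundary[OF \<Lambda>(4,1,3) subexponential_observable[OF \<Lambda>(1,2)]] by simp
      show "norm (- 2 * (\<Sum>j\<in>\<Lambda>. M j i * cov (\<mu> \<Lambda> (\<omega> (i := r))) f (\<lambda>x. x j))) \<le> K" for r
        using K by (simp only: real_norm_def)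
    qed auto
    \<comment> \<open>\<omega>' may differ from the updated \<omega> inside \<Lambda>, so the
      measures agree by \<open>gibbs_cong\<close> and not by equality of the configurations.\<close>
    moreover have "\<mu> \<Lambda> \<omega>' = \<mu> \<Lambda> (\<omega> (i := \<omega>' i))"
      by (rule gibbs_cong) (use \<omega>' in auto)
    ultimately have "\<bar>(\<integral>x. f x \<partial>\<mu> \<Lambda> \<omega>) - (\<integral>x. f x \<partial>\<mu> \<Lambda> \<omega>')\<bar> \<le> K * \<bar>\<omega>' i - \<omega> i\<bar>"
      by (simp add: abs_minus_commute)
    then show ?thesis unfolding K_def by (simp only: mult_ac)
  qed
  show ?thesis
    unfolding decay_of_boundary_influence_def
    by (rule exI[of _ C'], rule conjI[OF C'], rule exI[of _ \<alpha>'], rule conjI[OF \<alpha>'(1)],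
        rule exI[of _ \<beta>], rule conjI[OF pos(3)], intro allI impI, elim conjE, rule bound) auto
qed

end

theorem lemma2p3:
  fixes \<psi> \<psi>b \<psi>c :: "'d::finite site \<Rightarrow> real \<Rightarrow> real"
    and s :: "'d site \<Rightarrow> real"
    and M :: "'d site \<Rightarrow> 'd site \<Rightarrow> real"
    and C\<psi> \<delta> CM \<alpha>M :: real
  assumes M_sym: "\<And>i j. M i j = M j i"
    and \<psi>_split: "\<And>i r. \<psi> i r = \<psi>b i r + \<psi>c i r"
    and \<psi>c_diff: "\<And>i r. \<psi>c i differentiable (at r)"
    and \<psi>c_diff2: "\<And>i r. deriv (\<psi>c i) differentiable (at r)"
    and \<psi>c_convex: "\<And>i r. deriv (deriv (\<psi>c i)) r \<ge> 0"
    and \<psi>b_diff: "\<And>i r. \<psi>b i differentiable (at r)"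
    and \<psi>b_bound: "\<And>i r. \<bar>\<psi>b i r\<bar> + \<bar>deriv (\<psi>b i) r\<bar> \<le> C\<psi>"
    and \<delta>_pos: "\<delta> > 0"
    and M_summable: "\<And>i. (\<lambda>j. \<bar>M i j\<bar>) summable_on (- {i})"
    and M_dominant: "\<And>i. \<delta> + (\<Sum>\<^sub>\<infinity>j\<in>-{i}. \<bar>M i j\<bar>) \<le> M i i"
    and CM_pos: "CM > 0"
    and \<alpha>M_pos: "\<alpha>M > 0"
    and M_decay: "\<And>i j. \<bar>M i j\<bar> \<le> CM * (1 + real (site_norm (i - j))) powr (- (2 * real CARD('d) + \<alpha>M))"
  shows "decay_of_correlations \<psi> s M \<longleftrightarrow> decay_of_boundary_influence \<psi> s M"
proof -
  interpret spin_system \<psi> \<psi>b \<psi>c s M C\<psi> \<delta>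
    by unfold_locales (rule assms)+
  show ?thesis
    using correlations_imp_boundary_influence[OF CM_pos \<alpha>M_pos M_decay] boundary_influence_imp_correlations
    by blast
qed

end
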